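(* Let $(f_\lambda)_{\lambda\in I}$ be a one-parameter family of probability densities satisfying the standing assumptions of the context, and let $X$ have pdf $f_\lambda$. For $K<\Omega$ let $$H_\lambda^K(x)=\frac{\partial P_\lambda^K}{\partial\lambda}(x)\Big/\frac{\partial P_\lambda^K}{\partial\lambda}(\Omega)\;-\;\frac{\partial P_\lambda}{\partial\lambda}(x)\Big/\frac{\partial P_\lambda}{\partial\lambda}(\Omega),$$ where $P_\lambda(x)=\int_{-\infty}^{x}F_\lambda(t)\,dt$ and $P_\lambda^K(x)=\int_{-\infty}^{x}F_\lambda^K(t)\,dt$. Then there exists a threshold $\Theta_\lambda<\Omega$ such that, if $K\le\Theta_\lambda$, then $H_\lambda^K(x)>0$ for $x\in(-\infty,\kappa_\lambda]$, for some $\kappa_\lambda$ (which may depend on $K$) with $K<\kappa_\lambda<\Omega$. As a consequence, if the change of variable $\varphi$ is concave on $(-\infty,\kappa_\lambda]$ and linear on $[\kappa_\lambda,\Omega]$, then $Y=\varphi(X)$, with pdf $g_\lambda$, is more fragile at $L=\varphi(K)$ than $X$ at $K$, i.e. $V(Y,g_\lambda,L,u^-(\lambda))>V(X,f_\lambda,K,s^-(\lambda))$. Here $\varphi:\mathbb{R}\to\mathbb{R}$ is a strictly increasing, twice differentiable function with $\varphi(\Omega)=\Omega$ and $\frac{d\varphi}{dx}(x)>0$ for any $x<\Omega$.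
   Context: $I\subset\mathbb{R}$, $\lambda\in I$ is a parameter, $X$ is a real random variable whose distribution has pdf $f_\lambda$, and $\Omega\in\mathbb{R}$ is a fixed reference value. Put $F_\lambda(x)=\int_{-\infty}^{x}f_\lambda(t)\,dt$ and, for $K<\Omega$, $F_\lambda^K(x)=F_\lambda(\min(x,K))=\min(F_\lambda(x),F_\lambda(K))$. The left semi-absolute deviation of $X$ is $s^-(\lambda)=\int_{-\infty}^{\Omega}(\Omega-x)f_\lambda(x)\,dx=\int_{-\infty}^{\Omega}F_\lambda(x)\,dx$. Standing assumptions: $\lambda\mapsto s^-(\lambda)$ is continuous, strictly increasing and spans the whole range $[0,+\infty)$, with inverse function $s\mapsto\lambda(s)$; $\frac{\partial F_\lambda}{\partial\lambda}(x)>0$ for any $x<\Omega$; and the tail shortfall $\xi(K,s^-)=\int_{-\infty}^{K}(\Omega-x)f_{\lambda(s^-)}(x)\,dx$ is differentiable on $(-\infty,\Omega]\times[0,\infty)$. The (intrinsic) fragility of $X$, i.e. its $K$-left-tail-vega sensitivity, at stress level $K<\Omega$ and deviation level $s^-=s^-(\lambda)>0$, is $$V(X,f_\lambda,K,s^-)=\frac{\partial\xi}{\partial s^-}(K,s^-)=\Big(\int_{-\infty}^{K}(\Omega-x)\frac{\partial f_\lambda}{\partial\lambda}(x)\,dx\Big)\Big(\frac{ds^-}{d\lambda}\Big)^{-1}.$$ For $Y=\varphi(X)$ with pdf $g_\lambda$, the reference value is $\varphi(\Omega)=\Omega$, the left semi-absolute deviation is $u^-(\lambda)=\int_{-\infty}^{\Omega}(\Omega-y)g_\lambda(y)\,dy$,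 the tail shortfall is $\zeta(L,u^-(\lambda))=\int_{-\infty}^{L}(\Omega-y)g_\lambda(y)\,dy$, and the fragility $V(Y,g_\lambda,L,u^-(\lambda))=\frac{\partial\zeta}{\partial u^-}(L,u^-(\lambda))$ is defined in the same way as for $X$, with $(Y,g_\lambda,L,u^-)$ in place of $(X,f_\lambda,K,s^-)$ (differentiation is with respect to the semi-deviation of $Y$ itself).
   Formalization: φ is assumed not affine on (−∞,κ_λ], since for φ = id the two fragilities are equal and the strict inequality fails; and ∂F_λ/∂λ(x) = ∫_{−∞}^x ∂f_λ/∂λ is assumed for x<Ω, without which ∂P_λ/∂λ may jump at K. *)

theory Defs
  imports "HOL-Probability.Probability"
begin

text \<open>A family of densities is a function \<open>f :: real \<Rightarrow> real \<Rightarrow> real\<close>; \<open>f l\<close> is the density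
  at the parameter value \<open>l\<close> (written lambda in the literature).\<close>

definition cdf_at :: "(real \<Rightarrow> real \<Rightarrow> real) \<Rightarrow> real \<Rightarrow> real \<Rightarrow> real" where
  "cdf_at f l x = (LBINT t:{..x}. f l t)"

definition stopped_cdf :: "(real \<Rightarrow> real \<Rightarrow> real) \<Rightarrow> real \<Rightarrow> real \<Rightarrow> real \<Rightarrow> real" where
  "stopped_cdf f K l x = cdf_at f l (min x K)"

definition semi_dev :: "real \<Rightarrow> (real \<Rightarrow> real \<Rightarrow> real) \<Rightarrow> real \<Rightarrow> real" where
  "semi_dev \<Omega> f l = (LBINT x:{..\<Omega>}. (\<Omega> - x) * f l x)"

definition dev_param :: "real set \<Rightarrow> real \<Rightarrow> (real \<Rightarrow> real \<Rightarrow> real) \<Rightarrow> real \<Rightarrow> real" where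
  "dev_param I \<Omega> f s = the_inv_into I (semi_dev \<Omega> f) s"

definition tail_shortfall ::
  "real set \<Rightarrow> real \<Rightarrow> (real \<Rightarrow> real \<Rightarrow> real) \<Rightarrow> real \<Rightarrow> real \<Rightarrow> real" where
  "tail_shortfall I \<Omega> f K s = (LBINT x:{..K}. (\<Omega> - x) * f (dev_param I \<Omega> f s) x)"

text \<open>The \<open>K\<close>-left-tail-vega sensitivity. It is only meant for \<open>s > 0\<close>, an interior point of
  the range of the semi-deviation, so that the two-sided derivative is the right one.\<close>

definition fragility ::
  "real set \<Rightarrow> real \<Rightarrow> (real \<Rightarrow> real \<Rightarrow> real) \<Rightarrow> real \<Rightarrow> real \<Rightarrow> real" where
  "fragility I \<Omega> f K s = deriv (\<lambda>t. tail_shortfall I \<Omega> f K t) s"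

definition int_cdf :: "(real \<Rightarrow> real \<Rightarrow> real) \<Rightarrow> real \<Rightarrow> real \<Rightarrow> real" where
  "int_cdf f l x = (LBINT t:{..x}. cdf_at f l t)"

definition int_stopped_cdf :: "(real \<Rightarrow> real \<Rightarrow> real) \<Rightarrow> real \<Rightarrow> real \<Rightarrow> real \<Rightarrow> real" where
  "int_stopped_cdf f K l x = (LBINT t:{..x}. stopped_cdf f K l t)"

definition transfer_fn ::
  "real \<Rightarrow> (real \<Rightarrow> real \<Rightarrow> real) \<Rightarrow> real \<Rightarrow> real \<Rightarrow> real \<Rightarrow> real" where
  "transfer_fn \<Omega> f K l x =
     deriv (\<lambda>m. int_stopped_cdf f K m x) l / deriv (\<lambda>m. int_stopped_cdf f K m \<Omega>) l
     - deriv (\<lambda>m. int_cdf f m x) l / deriv (\<lambda>m. int_cdf f m \<Omega>) l"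

text \<open>The pointwise conditions are imposed at parameters with positive semi-deviation only. Since
  \<open>I\<close> is an interval and the semi-deviation is strictly increasing onto \<open>{0..}\<close>, these are exactly
  the interior points of \<open>I\<close>, so two-sided derivatives are appropriate there. The last five
  conditions are the regularity needed for the vega formula
  \<open>V = (\<integral>\<^sub>{x \<le> K} (\<Omega> - x) \<partial>f/\<partial>l) / (ds/dl)\<close> and for differentiating the distribution
  function under the integral sign.\<close>

locale fragility_family =
  fixes I :: "real set" and \<Omega> :: real and f :: "real \<Rightarrow> real \<Rightarrow> real"
  assumes interval: "is_interval I"
    and density_measurable: "\<And>l. l \<in> I \<Longrightarrow> f l \<in> borel_measurable borel"
    and density_nonneg: "\<And>l x. l \<in> I \<Longrightarrow> 0 \<le> f l x"
    and density_total: "\<And>l. l \<in> I \<Longrightarrow> has_bochner_integral lborel (f l) 1"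
    and dev_finite: "\<And>l. l \<in> I \<Longrightarrow> set_integrable lborel {..\<Omega>} (\<lambda>x. (\<Omega> - x) * f l x)"
    and dev_continuous: "continuous_on I (semi_dev \<Omega> f)"
    and dev_strict_mono: "strict_mono_on I (semi_dev \<Omega> f)"
    and dev_range: "semi_dev \<Omega> f ` I = {0..}"
    and cdf_increasing: "\<And>l x. l \<in> I \<Longrightarrow> 0 < semi_dev \<Omega> f l \<Longrightarrow> x < \<Omega> \<Longrightarrow>
           \<exists>D>0. ((\<lambda>m. cdf_at f m x) has_real_derivative D) (at l)"
    and shortfall_differentiable:
          "(\<lambda>(K, s). tail_shortfall I \<Omega> f K s) differentiable_on ({..\<Omega>} \<times> {0..})"
    and dev_differentiable: "\<And>l. l \<in> I \<Longrightarrow> 0 < semi_dev \<Omega> f l \<Longrightarrow>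
           semi_dev \<Omega> f differentiable (at l)"
    and density_differentiable: "\<And>l. l \<in> I \<Longrightarrow> 0 < semi_dev \<Omega> f l \<Longrightarrow>
           AE x in lborel. x < \<Omega> \<longrightarrow> (\<lambda>m. f m x) differentiable (at l)"
    and vega_integrable: "\<And>l K. l \<in> I \<Longrightarrow> 0 < semi_dev \<Omega> f l \<Longrightarrow> K < \<Omega> \<Longrightarrow>
           set_integrable lborel {..K} (\<lambda>x. (\<Omega> - x) * deriv (\<lambda>m. f m x) l)"
    and cdf_deriv: "\<And>l x. l \<in> I \<Longrightarrow> 0 < semi_dev \<Omega> f l \<Longrightarrow> x < \<Omega> \<Longrightarrow>
           deriv (\<lambda>m. cdf_at f m x) l = (LBINT t:{..x}. deriv (\<lambda>m. f m t) l)"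
    and vega_formula: "\<And>l K. l \<in> I \<Longrightarrow> 0 < semi_dev \<Omega> f l \<Longrightarrow> K < \<Omega> \<Longrightarrow>
           fragility I \<Omega> f K (semi_dev \<Omega> f l)
             = (LBINT x:{..K}. (\<Omega> - x) * deriv (\<lambda>m. f m x) l) * inverse (deriv (semi_dev \<Omega> f) l)"

definition affine_fun_on :: "real set \<Rightarrow> (real \<Rightarrow> real) \<Rightarrow> bool" where
  "affine_fun_on S \<phi> \<longleftrightarrow> (\<exists>a b. \<forall>x\<in>S. \<phi> x = a * x + b)"

definition change_of_variable :: "real \<Rightarrow> (real \<Rightarrow> real) \<Rightarrow> bool" where
  "change_of_variable \<Omega> \<phi> \<longleftrightarrow>
     strict_mono \<phi> \<and>
     (\<forall>x. \<phi> differentiable (at x)) \<and> (\<forall>x. deriv \<phi> differentiable (at x)) \<and>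
     \<phi> \<Omega> = \<Omega> \<and> (\<forall>x<\<Omega>. 0 < deriv \<phi> x)"

definition has_pdf :: "'a measure \<Rightarrow> ('a \<Rightarrow> real) \<Rightarrow> (real \<Rightarrow> real) \<Rightarrow> bool" where
  "has_pdf M X h \<longleftrightarrow> (\<forall>x. 0 \<le> h x) \<and> distributed M lborel X (\<lambda>x. ennreal (h x))"

text \<open>Finiteness of all semi-deviations of \<open>g\<close> and existence of the derivative defining
  \<open>fragility I \<Omega> g L (semi_dev \<Omega> g l)\<close>; without them the library integral and \<open>deriv\<close> would
  return arbitrary values.\<close>

definition fragility_defined ::
  "real set \<Rightarrow> real \<Rightarrow> (real \<Rightarrow> real \<Rightarrow> real) \<Rightarrow> real \<Rightarrow> real \<Rightarrow> bool" where
  "fragility_defined I \<Omega> g L l \<longleftrightarrow>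
     (\<forall>m\<in>I. set_integrable lborel {..\<Omega>} (\<lambda>y. (\<Omega> - y) * g m y)) \<and>
     (\<lambda>t. tail_shortfall I \<Omega> g L t) differentiable (at (semi_dev \<Omega> g l))"

end

theory Submission
  imports Defs
begin

text \<open>Write \<open>D\<close> for the parameter derivative of the distribution function, \<open>p x\<close> for its integral
  over \<open>{..x}\<close> and \<open>q K = p K + (\<Omega> - K) * D K\<close> for the derivative of the tail shortfall.
  The fragility of \<open>X\<close> at \<open>K\<close> is \<open>V = q K / s'\<close>, with \<open>s'\<close> the derivative of the semi-deviation.
  Since \<open>q K\<close> tends to \<open>0\<close> at minus infinity, \<open>V < 1\<close> for small \<open>K\<close>; this makes the transfer function
  positive up to \<open>K\<close>, and by continuity slightly beyond \<open>K\<close>.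

  Let \<open>a\<close> be the slope of \<open>\<phi>\<close> on \<open>{\<kappa>..\<Omega>}\<close> and \<open>w = \<phi>' - a\<close>, which is nonnegative and decreasing on
  \<open>{..\<kappa>}\<close> and vanishes at \<open>\<kappa>\<close>. Integration by parts expresses the semi-deviation and the shortfall of
  \<open>Y\<close> through those of \<open>X\<close> and the \<open>w\<close>-weighted integrals of the distribution function. Comparing
  the two sensitivities reduces to
  \<open>(1 - V) * (\<integral>\<^sub>{x \<le> K} w D) + (\<integral>\<^sub>{K \<le> x \<le> \<kappa>} w (D K - V D)) > 0\<close>, and by the second mean value
  theorem the second integral is \<open>w K\<close> times an integral over some \<open>{K..c}\<close>, which the positivity of
  the transfer function at \<open>c\<close> bounds from below.\<close>

section \<open>Integrals over left half-lines\<close>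

text \<open>Fubini for the kernel \<open>k\<close> on the region x \<le> t \<le> b: integrating over
  t first gives \<open>v b - v x\<close> by the fundamental theorem, integrating over x first gives
  the running integral of \<open>h\<close>. Integrability of \<open>(v b - v x) * h x\<close> is
  what makes \<open>k\<close> integrable on the product.\<close>

lemma tail_integral_by_parts:
  fixes v w h :: "real \<Rightarrow> real"
  assumes w [measurable]: "w \<in> borel_measurable borel"
    and deriv: "\<And>x. x \<le> b \<Longrightarrow> (v has_real_derivative w x) (at x)"
    and nonneg: "\<And>x. x \<le> b \<Longrightarrow> 0 \<le> w x"
    and h: "set_integrable lborel {..b} h"
    and vh: "set_integrable lborel {..b} (\<lambda>x. (v b - v x) * h x)"
  shows "set_integrable lborel {..b} (\<lambda>t. w t * (LBINT x:{..t}. h x))"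
    and "(LBINT t:{..b}. w t * (LBINT x:{..t}. h x)) = (LBINT x:{..b}. (v b - v x) * h x)"
proof -
  define h' where "h' x = indicator {..b} x * h x" for x
  define k where "k = (\<lambda>(x::real, t). if x \<le> t \<and> t \<le> b then w t * h' x else 0)"
  have [measurable]: "h' \<in> borel_measurable borel"
    using h by (simp add: set_integrable_def h'_def[abs_def])
  have k [measurable]: "k \<in> borel_measurable (lborel \<Otimes>\<^sub>M lborel)"
    unfolding k_def by measurable
  have slice: "has_bochner_integral lborel (\<lambda>t. k (x, t)) ((v b - v x) * h' x)" for x
  proof (cases "x \<le> b")
    case True
    have "has_bochner_integral lborel (\<lambda>t. w t * indicator {x..b} t) (v b - v x)"
      by (rule has_bochner_integral_FTC_Icc_nonneg) (use True deriv nonneg in auto)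
    from has_bochner_integral_mult_left[OF this, of "h' x"]
    show ?thesis
      by (rule has_bochner_integral_cong[THEN iffD1, rotated 3])
        (auto simp: k_def split: split_indicator)
  next
    case False
    then show ?thesis
      by (auto simp: k_def h'_def has_bochner_integral_zero intro!: has_bochner_integral_cong[THEN iffD1, OF _ _ _ has_bochner_integral_zero])
  qed
  have norm_slice: "(LBINT t. norm (k (x, t))) = norm ((v b - v x) * h' x)" for x
  proof -
    \<comment> \<open>As \<open>w\<close> is nonnegative on the region, the sign of
      \<open>k (x, t)\<close> does not vary with t, so the absolute slice integral follows from the
      signed one.\<close>
    have "norm (k (x, t)) = sgn (h' x) * k (x, t)" for t
      using nonneg[of t] by (auto simp: k_def abs_mult abs_sgn[of "h' x"])
    then have "(LBINT t. norm (k (x, t))) = sgn (h' x) * ((v b - v x) * h' x)"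
      using slice[of x] by (simp add: has_bochner_integral_iff)
    moreover have "v x \<le> v b" if "x \<le> b"
    proof (rule DERIV_nonneg_imp_nondecreasing[OF that])
      show "\<exists>y. (v has_real_derivative y) (at z) \<and> 0 \<le> y" if "x \<le> z" "z \<le> b" for z
        using deriv[OF that(2)] nonneg[OF that(2)] by blast
    qed
    ultimately show ?thesis
      by (auto simp: h'_def abs_mult abs_sgn[of "h x"] indicator_def mult_ac)
  qed
  have int: "integrable lborel (\<lambda>x. (v b - v x) * h' x)"
    using vh by (simp add: set_integrable_def h'_def[abs_def] mult_ac)
  have "integrable (lborel \<Otimes>\<^sub>M lborel) k"
    by (rule lborel_pair.Fubini_integrable)
       (use int slice in \<open>auto simp: norm_slice has_bochner_integral_iff simp del: real_norm_def intro!: integrable_norm\<close>)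
  then have k': "integrable (lborel \<Otimes>\<^sub>M lborel) (case_prod (\<lambda>x t. k (x, t)))"
    by simp
  have inner: "(LBINT x. k (x, t)) = indicator {..b} t * (w t * (LBINT x:{..t}. h x))" for t
  proof (cases "t \<le> b")
    case True
    have "(LBINT x. k (x, t)) = (LBINT x. w t * (indicator {..t} x * h x))"
      using True by (intro Bochner_Integration.integral_cong) (auto simp: k_def h'_def split: split_indicator)
    then show ?thesis
      using True by (simp add: set_lebesgue_integral_def)
  qed (simp add: k_def)
  show "set_integrable lborel {..b} (\<lambda>t. w t * (LBINT x:{..t}. h x))"
    using lborel_pair.integrable_snd[OF k'] by (simp add: inner set_integrable_def)
  have "(LBINT t. LBINT x. k (x, t)) = (LBINT x. LBINT t. k (x, t))"
    by (rule lborel_pair.Fubini_integral[OF k'])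
  then show "(LBINT t:{..b}. w t * (LBINT x:{..t}. h x)) = (LBINT x:{..b}. (v b - v x) * h x)"
    using slice by (simp add: inner has_bochner_integral_iff set_lebesgue_integral_def h'_def mult_ac)
qed

lemma set_integrable_mult_bounded:
  fixes G v :: "'a \<Rightarrow> real"
  assumes G: "set_integrable M A G" and v [measurable]: "v \<in> borel_measurable M"
    and B: "\<And>x. x \<in> A \<Longrightarrow> \<bar>v x\<bar> \<le> B"
  shows "set_integrable M A (\<lambda>x. v x * G x)"
proof (rule set_integrable_bound)
  show "set_integrable M A (\<lambda>x. B * G x)"
    using G by simp
  have [measurable]: "(\<lambda>x. indicator A x * G x) \<in> borel_measurable M"
    using G by (simp add: set_integrable_def)
  have "(\<lambda>x. v x * (indicator A x * G x)) \<in> borel_measurable M"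
    by measurable
  then show "set_borel_measurable M A (\<lambda>x. v x * G x)"
    by (simp add: set_borel_measurable_def mult_ac)
  show "AE x in M. x \<in> A \<longrightarrow> norm (v x * G x) \<le> norm (B * G x)"
  proof (intro AE_I2 impI)
    fix x assume "x \<in> A"
    from B[OF this] show "norm (v x * G x) \<le> norm (B * G x)"
      by (auto simp: abs_mult intro!: mult_right_mono)
  qed
qed

text \<open>Scheffe's lemma turns pointwise convergence of nonnegative functions together with
  convergence of their integrals into L1 convergence, which survives a bounded weight. It serves for
  the parameter difference quotients of the distribution function, where the limit of the integrals
  is known but no dominating function is.\<close>

lemma tendsto_weighted_integral_Scheffe:
  fixes F :: "nat \<Rightarrow> 'a \<Rightarrow> real"
  assumes F: "\<And>n. set_integrable M A (F n)" and D: "set_integrable M A D"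
    and A [measurable]: "A \<in> sets M"
    and nonneg: "\<And>n x. x \<in> A \<Longrightarrow> 0 \<le> F n x" "\<And>x. x \<in> A \<Longrightarrow> 0 \<le> D x"
    and lim: "\<And>x. x \<in> A \<Longrightarrow> (\<lambda>n. F n x) \<longlonglongrightarrow> D x"
    and int_lim: "(\<lambda>n. LINT x:A|M. F n x) \<longlonglongrightarrow> (LINT x:A|M. D x)"
    and v [measurable]: "v \<in> borel_measurable M" and B: "\<And>x. x \<in> A \<Longrightarrow> \<bar>v x\<bar> \<le> B"
  shows "(\<lambda>n. LINT x:A|M. v x * F n x) \<longlonglongrightarrow> (LINT x:A|M. v x * D x)"
proof -
  have F': "set_integrable M A (\<lambda>x. v x * F n x)" for n
    by (rule set_integrable_mult_bounded[OF F v B])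
  have D': "set_integrable M A (\<lambda>x. v x * D x)"
    by (rule set_integrable_mult_bounded[OF D v B])
  let ?F = "\<lambda>n x. indicator A x * F n x" and ?D = "\<lambda>x. indicator A x * D x"
  have i: "integrable M (?F n)" "integrable M ?D" for n
    using F D by (auto simp: set_integrable_def)
  have nn: "(\<integral>\<^sup>+ x. norm (?F n x) \<partial>M) = ennreal (LINT x:A|M. F n x)"
    "(\<integral>\<^sup>+ x. norm (?D x) \<partial>M) = ennreal (LINT x:A|M. D x)" for n
    using nonneg i by (auto simp: set_lebesgue_integral_def nn_integral_eq_integral[symmetric]
        indicator_def intro!: nn_integral_cong)
  have "(\<lambda>n. \<integral>\<^sup>+ x. norm (?F n x - ?D x) \<partial>M) \<longlonglongrightarrow> 0"
  proof (rule Scheffe_lemma1)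
    show "limsup (\<lambda>n. \<integral>\<^sup>+ x. norm (?F n x) \<partial>M) \<le> (\<integral>\<^sup>+ x. norm (?D x) \<partial>M)"
      unfolding nn using lim_imp_Limsup[OF _ tendsto_ennrealI[OF int_lim]] by simp
  qed (use i lim in \<open>auto simp: indicator_def\<close>)
  then have "(\<lambda>n. ennreal (LINT x|M. norm (?F n x - ?D x))) \<longlonglongrightarrow> ennreal 0"
    by (subst (asm) nn_integral_eq_integral) (use i in auto)
  then have L1: "(\<lambda>n. LINT x|M. norm (?F n x - ?D x)) \<longlonglongrightarrow> 0"
    by (subst (asm) tendsto_ennreal_iff) auto
  have "(\<lambda>n. (LINT x:A|M. v x * F n x) - (LINT x:A|M. v x * D x)) \<longlonglongrightarrow> 0"
  proof (rule Lim_null_comparison)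
    show "(\<lambda>n. B * (LINT x|M. norm (?F n x - ?D x))) \<longlonglongrightarrow> 0"
      using tendsto_mult_left[OF L1, of B] by simp
    have "norm ((LINT x:A|M. v x * F n x) - (LINT x:A|M. v x * D x))
        \<le> B * (LINT x|M. norm (?F n x - ?D x))" for n
    proof -
      have "(LINT x:A|M. v x * F n x) - (LINT x:A|M. v x * D x)
          = (LINT x|M. indicator A x * (v x * F n x - v x * D x))"
        using F'[of n] D' by (subst set_integral_diff(2)[symmetric]) (auto simp: set_lebesgue_integral_def)
      also have "norm \<dots> \<le> (LINT x|M. norm (indicator A x * (v x * F n x - v x * D x)))"
        by (rule integral_norm_bound)
      also have "\<dots> \<le> (LINT x|M. B * norm (?F n x - ?D x))"
      proof (rule integral_mono)
        show "integrable M (\<lambda>x. norm (indicator A x * (v x * F n x - v x * D x)))"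
          using set_integral_diff(1)[OF F'[of n] D'] by (intro integrable_norm) (simp add: set_integrable_def)
        show "integrable M (\<lambda>x. B * norm (?F n x - ?D x))"
          using i by auto
        show "norm (indicator A x * (v x * F n x - v x * D x)) \<le> B * norm (?F n x - ?D x)" for x
          using B[of x]
          by (auto simp: abs_mult right_diff_distrib[symmetric] intro!: mult_right_mono split: split_indicator)
      qed
      finally show ?thesis by simp
    qed
    then show "\<forall>\<^sub>F n in sequentially. norm ((LINT x:A|M. v x * F n x) - (LINT x:A|M. v x * D x))
        \<le> B * (LINT x|M. norm (?F n x - ?D x))"
      by simp
  qed
  then show "(\<lambda>n. LINT x:A|M. v x * F n x) \<longlonglongrightarrow> (LINT x:A|M. v x * D x)"
    by (simp add: LIM_zero_iff)
qed

lemma set_integral_split_Iic: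
  fixes h :: "real \<Rightarrow> real"
  assumes "set_integrable lborel {..b} h" "a \<le> b"
  shows "(LBINT x:{..b}. h x) = (LBINT x:{..a}. h x) + (LBINT x:{a..b}. h x)"
proof -
  have "(LBINT x:{..a} \<union> {a..b}. h x) = (LBINT x:{..a}. h x) + (LBINT x:{a..b}. h x)"
  proof (rule set_integral_Un_AE)
    show "AE x in lborel. \<not> (x \<in> {..a} \<and> x \<in> {a..b})"
      using AE_lborel_singleton[of a] by eventually_elim auto
  qed (use assms in \<open>auto intro: set_integrable_subset[OF assms(1)]\<close>)
  moreover have "{..a} \<union> {a..b} = {..b}"
    using assms(2) by auto
  ultimately show ?thesis by simp
qed

lemma set_integral_pos:
  fixes h :: "'a \<Rightarrow> real"
  assumes h: "set_integrable M A h" and A: "A \<in> sets M" and nonneg: "\<And>x. x \<in> A \<Longrightarrow> 0 \<le> h x"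
    and B: "B \<in> sets M" "B \<subseteq> A" "emeasure M B \<noteq> 0" and pos: "\<And>x. x \<in> B \<Longrightarrow> 0 < h x"
  shows "0 < (LINT x:A|M. h x)"
proof -
  have ge: "0 \<le> indicator A x * h x" for x
    using nonneg[of x] by (auto simp: indicator_def)
  have i: "integrable M (\<lambda>x. indicator A x * h x)"
    using h by (simp add: set_integrable_def)
  have "0 \<le> (LINT x:A|M. h x)"
    unfolding set_lebesgue_integral_def using ge by (auto intro!: Bochner_Integration.integral_nonneg)
  moreover have "(LINT x:A|M. h x) \<noteq> 0"
  proof
    assume "(LINT x:A|M. h x) = 0"
    then have "AE x in M. indicator A x * h x = 0"
      using integral_nonneg_eq_0_iff_AE[OF i] ge by (simp add: set_lebesgue_integral_def)
    then have "AE x in M. x \<notin> B"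
      by eventually_elim (use B pos in \<open>force simp: indicator_def\<close>)
    then show False
      using B by (simp add: AE_iff_measurable[OF B(1)] sets.sets_into_space Collect_conj_eq Int_absorb1)
  qed
  ultimately show ?thesis by linarith
qed

section \<open>Concave functions and changes of variable\<close>

text \<open>Adding the tangent inequalities at two interior points gives the claim below \<kappa>.
  The tangent inequality is available at interior points only, so the endpoint \<kappa> is reached
  through the left limit of \<open>\<phi>'\<close>.\<close>

lemma concave_on_deriv_antimono:
  fixes \<phi> \<phi>' :: "real \<Rightarrow> real"
  assumes deriv: "\<And>x. (\<phi> has_real_derivative \<phi>' x) (at x)"
    and cont: "isCont \<phi>' \<kappa>"
    and concave: "concave_on {..\<kappa>} \<phi>"
    and "x \<le> y" "y \<le> \<kappa>"
  shows "\<phi>' y \<le> \<phi>' x"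
proof -
  have tangent: "\<phi> t - \<phi> s \<le> \<phi>' s * (t - s)" if "s < \<kappa>" "t \<le> \<kappa>" for s t
  proof -
    have "(- \<phi>' s) * (t - s) \<le> - \<phi> t - - \<phi> s"
    proof (rule convex_on_imp_above_tangent)
      show "convex_on {..\<kappa>} (\<lambda>x. - \<phi> x)"
        using concave by (simp add: concave_on_def)
      show "((\<lambda>x. - \<phi> x) has_real_derivative - \<phi>' s) (at s within {..\<kappa>})"
        by (rule has_field_derivative_at_within[OF DERIV_minus[OF deriv]])
    qed (use that in auto)
    then show ?thesis by (simp add: algebra_simps)
  qed
  have strict: "\<phi>' t \<le> \<phi>' s" if "s < t" "t < \<kappa>" for s t
  proof -
    have "(\<phi>' t - \<phi>' s) * (t - s) \<le> 0"
      using tangent[of s t] tangent[of t s] that by (simp add: algebra_simps)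
    then show ?thesis
      using that by (simp add: mult_le_0_iff)
  qed
  consider "x = y" | "x < y" "y < \<kappa>" | "x < \<kappa>" "y = \<kappa>"
    using assms(4,5) by linarith
  then show ?thesis
  proof cases
    case 3
    have "(\<phi>' \<longlongrightarrow> \<phi>' \<kappa>) (at_left \<kappa>)"
      using cont by (simp add: continuous_at filterlim_at_split)
    moreover have "\<forall>\<^sub>F t in at_left \<kappa>. \<phi>' t \<le> \<phi>' x"
      using eventually_at_left_real[OF 3(1)] by eventually_elim (use strict in auto)
    ultimately show ?thesis
      using 3(2) by (simp add: tendsto_upperbound)
  qed (use strict in auto)
qed

lemma affine_slope_eq_deriv:
  assumes deriv: "(\<phi> has_real_derivative d) (at \<kappa>)" and "\<kappa> < \<Omega>"
    and affine: "\<And>x. \<kappa> \<le> x \<Longrightarrow> x \<le> \<Omega> \<Longrightarrow> \<phi> x = a * x + b"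
  shows "d = a"
proof (rule tendsto_unique)
  show "((\<lambda>x. (\<phi> x - \<phi> \<kappa>) / (x - \<kappa>)) \<longlongrightarrow> d) (at_right \<kappa>)"
    using deriv by (simp add: has_field_derivative_iff filterlim_at_split)
  have "\<forall>\<^sub>F x in at_right \<kappa>. (\<phi> x - \<phi> \<kappa>) / (x - \<kappa>) = a"
    using eventually_at_right_real[OF \<open>\<kappa> < \<Omega>\<close>]
    by eventually_elim (use \<open>\<kappa> < \<Omega>\<close> in \<open>simp add: affine divide_eq_eq algebra_simps\<close>)
  then show "((\<lambda>x. (\<phi> x - \<phi> \<kappa>) / (x - \<kappa>)) \<longlongrightarrow> a) (at_right \<kappa>)"
    by (rule tendsto_eventually)
qed simp

text \<open>Both integrals are the same expectation, that of c(\<phi>(X)) on the event X \<le> b,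
  which equals the event \<phi>(X) \<le> \<phi>(b) by strict monotonicity. Stated this way it holds
  for every version of the density of Y.\<close>

lemma pdf_pullback:
  fixes X :: "'a \<Rightarrow> real"
  assumes X: "has_pdf M X h" and Y: "has_pdf M (\<lambda>\<omega>. \<phi> (X \<omega>)) g"
    and \<phi>: "strict_mono \<phi>" and c [measurable]: "c \<in> borel_measurable borel"
  shows "set_integrable lborel {..\<phi> b} (\<lambda>y. c y * g y) \<longleftrightarrow>
      set_integrable lborel {..b} (\<lambda>x. c (\<phi> x) * h x)"
    and "(LBINT y:{..\<phi> b}. c y * g y) = (LBINT x:{..b}. c (\<phi> x) * h x)"
proof -
  have [measurable]: "\<phi> \<in> borel_measurable borel"
    using \<phi> by (intro borel_measurable_mono strict_mono_mono)
  have ind: "indicator {..\<phi> b} (\<phi> x) = (indicator {..b} x :: real)" for x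
    using \<phi> by (simp add: indicator_def strict_mono_less_eq)
  have dX: "distributed M lborel X (\<lambda>x. ennreal (h x))" "\<And>x. 0 \<le> h x"
    using X by (auto simp: has_pdf_def)
  have dY: "distributed M lborel (\<lambda>\<omega>. \<phi> (X \<omega>)) (\<lambda>y. ennreal (g y))" "\<And>y. 0 \<le> g y"
    using Y by (auto simp: has_pdf_def)
  let ?cY = "\<lambda>y. indicator {..\<phi> b} y * c y" and ?cX = "\<lambda>x. indicator {..b} x * c (\<phi> x)"
  have m: "?cY \<in> borel_measurable lborel" "?cX \<in> borel_measurable lborel"
    by measurable
  have "integrable lborel (\<lambda>y. g y * ?cY y) \<longleftrightarrow> integrable lborel (\<lambda>x. h x * ?cX x)"
    using distributed_integrable[OF dY(1) m(1)] distributed_integrable[OF dX(1) m(2)] dX(2) dY(2)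
    by (simp add: ind)
  then show "set_integrable lborel {..\<phi> b} (\<lambda>y. c y * g y) \<longleftrightarrow>
      set_integrable lborel {..b} (\<lambda>x. c (\<phi> x) * h x)"
    by (simp add: set_integrable_def mult_ac)
  have "(LBINT y. g y * ?cY y) = (LBINT x. h x * ?cX x)"
    using distributed_integral[OF dY(1) m(1)] distributed_integral[OF dX(1) m(2)] dX(2) dY(2)
    by (simp add: ind)
  then show "(LBINT y:{..\<phi> b}. c y * g y) = (LBINT x:{..b}. c (\<phi> x) * h x)"
    by (simp add: set_lebesgue_integral_def mult_ac)
qed

lemma quotient_tendsto:
  assumes "(g has_real_derivative d) (at x)" "s \<longlonglongrightarrow> x" "\<And>n. s n \<noteq> x"
  shows "(\<lambda>n. (g (s n) - g x) / (s n - x)) \<longlonglongrightarrow> d"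
proof -
  have "filterlim s (at x) sequentially"
    using assms(2,3) by (simp add: filterlim_at)
  moreover have "((\<lambda>y. (g y - g x) / (y - x)) \<longlongrightarrow> d) (at x)"
    using assms(1) by (simp add: has_field_derivative_iff)
  ultimately show ?thesis
    by (rule filterlim_compose[rotated])
qed

section \<open>Monotonicity in the parameter\<close>

context fragility_family
begin

lemma density_set_integrable:
  assumes "m \<in> I" "A \<in> sets borel"
  shows "set_integrable lborel A (f m)"
proof (rule set_integrable_subset)
  show "set_integrable lborel UNIV (f m)"
    using density_total[OF assms(1)] by (simp add: set_integrable_def has_bochner_integral_iff)
qed (use assms in auto)

lemma linear_density_integrable:
  assumes "m \<in> I" "x \<le> \<Omega>"
  shows "set_integrable lborel {..x} (\<lambda>t. (c - t) * f m t)"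
proof -
  have "set_integrable lborel {..x} (\<lambda>t. (\<Omega> - t) * f m t)"
    using dev_finite[OF assms(1)] by (rule set_integrable_subset) (use assms in auto)
  then have "set_integrable lborel {..x} (\<lambda>t. (\<Omega> - t) * f m t + (c - \<Omega>) * f m t)"
    using density_set_integrable[OF assms(1), of "{..x}"] by (intro set_integral_add(1)) auto
  then show ?thesis
    by (simp add: algebra_simps)
qed

lemma cdf_nonneg: "m \<in> I \<Longrightarrow> 0 \<le> cdf_at f m x"
  unfolding cdf_at_def set_lebesgue_integral_def
  by (auto intro!: Bochner_Integration.integral_nonneg simp: density_nonneg)

definition shortfall :: "real \<Rightarrow> real \<Rightarrow> real" where
  "shortfall K m = (LBINT x:{..K}. (\<Omega> - x) * f m x)"

lemma shortfall_Omega: "shortfall \<Omega> m = semi_dev \<Omega> f m"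
  by (simp add: shortfall_def semi_dev_def)

text \<open>Integration by parts with weight 1 turns the integrated distribution function into the
  integral of \<open>(x - t) * f m t\<close>; then write x - t as (\<Omega> - t) - (\<Omega> -
  x).\<close>

lemma
  assumes m: "m \<in> I" and x: "x \<le> \<Omega>"
  shows cdf_integrable: "set_integrable lborel {..x} (cdf_at f m)"
    and int_cdf_eq: "int_cdf f m x = shortfall x m - (\<Omega> - x) * cdf_at f m x"
proof -
  note parts = tail_integral_by_parts[of "\<lambda>_. 1" x "\<lambda>t. t" "f m", OF _ _ _
      density_set_integrable[OF m] linear_density_integrable[OF m x]]
  show "set_integrable lborel {..x} (cdf_at f m)"
    using parts(1) by (simp add: cdf_at_def[abs_def])
  have "int_cdf f m x = (LBINT t:{..x}. (x - t) * f m t)"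
    using parts(2) by (simp add: int_cdf_def cdf_at_def[abs_def])
  also have "\<dots> = (LBINT t:{..x}. (\<Omega> - t) * f m t - (\<Omega> - x) * f m t)"
    by (simp add: algebra_simps)
  also have "\<dots> = shortfall x m - (\<Omega> - x) * cdf_at f m x"
    using density_set_integrable[OF m, of "{..x}"] linear_density_integrable[OF m x]
    by (subst set_integral_diff(2)) (auto simp: shortfall_def cdf_at_def)
  finally show "int_cdf f m x = shortfall x m - (\<Omega> - x) * cdf_at f m x" .
qed

lemma int_cdf_Omega: "m \<in> I \<Longrightarrow> int_cdf f m \<Omega> = semi_dev \<Omega> f m"
  by (simp add: int_cdf_eq shortfall_Omega)

lemma int_stopped_cdf_below: "x \<le> K \<Longrightarrow> int_stopped_cdf f K m x = int_cdf f m x"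
  unfolding int_stopped_cdf_def int_cdf_def
  by (intro set_lebesgue_integral_cong) (auto simp: stopped_cdf_def min_def)

lemma int_stopped_cdf_above:
  assumes m: "m \<in> I" and "K \<le> x" "K \<le> \<Omega>"
  shows "int_stopped_cdf f K m x = int_cdf f m K + (x - K) * cdf_at f m K"
proof -
  have 1: "set_integrable lborel {..K} (stopped_cdf f K m)"
    using cdf_integrable[OF m \<open>K \<le> \<Omega>\<close>]
    by (rule set_integrable_cong[THEN iffD1, rotated -1]) (auto simp: stopped_cdf_def min_def)
  have 2: "set_integrable lborel {K..x} (stopped_cdf f K m)"
    by (rule set_integrable_cong[THEN iffD1, rotated -1, of _ _ "\<lambda>_. cdf_at f m K"])
      (auto simp: stopped_cdf_def min_def set_integrable_def emeasure_lborel_Icc_eq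
        intro!: integrable_mult_left integrable_real_indicator)
  have "set_integrable lborel ({..K} \<union> {K..x}) (stopped_cdf f K m)"
    using 1 2 by (rule set_integrable_Un) auto
  moreover have "{..K} \<union> {K..x} = {..x}"
    using assms by auto
  ultimately have "set_integrable lborel {..x} (stopped_cdf f K m)"
    by simp
  from set_integral_split_Iic[OF this \<open>K \<le> x\<close>] have "int_stopped_cdf f K m x
      = int_stopped_cdf f K m K + (LBINT t:{K..x}. stopped_cdf f K m t)"
    by (simp add: int_stopped_cdf_def)
  also have "(LBINT t:{K..x}. stopped_cdf f K m t) = (LBINT t:{K..x}. cdf_at f m K)"
    by (intro set_lebesgue_integral_cong) (auto simp: stopped_cdf_def min_def)
  also have "\<dots> = (x - K) * cdf_at f m K"
    using \<open>K \<le> x\<close> by (simp add: set_lebesgue_integral_def)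
  finally show ?thesis
    by (simp add: int_stopped_cdf_below)
qed

lemma dev_inj: "inj_on (semi_dev \<Omega> f) I"
  using dev_strict_mono by (rule strict_mono_on_imp_inj_on)

lemma dev_less: "a \<in> I \<Longrightarrow> b \<in> I \<Longrightarrow> a < b \<Longrightarrow> semi_dev \<Omega> f a < semi_dev \<Omega> f b"
  using dev_strict_mono by (auto simp: strict_mono_on_def)

lemma dev_nonneg: "a \<in> I \<Longrightarrow> 0 \<le> semi_dev \<Omega> f a"
  using imageI[of a I "semi_dev \<Omega> f"] by (simp add: dev_range)

lemma segment_subset: "a \<in> I \<Longrightarrow> b \<in> I \<Longrightarrow> a \<le> x \<Longrightarrow> x \<le> b \<Longrightarrow> x \<in> I"
  by (rule mem_is_interval_1_I[OF interval])

text \<open>Half and twice the semi-deviation at \<open>l\<close> are also attained, and strict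
  monotonicity places their preimages on either side of \<open>l\<close>.\<close>

lemma dev_interior:
  assumes l: "l \<in> I" "0 < semi_dev \<Omega> f l"
  obtains a b where "a \<in> I" "b \<in> I" "a < l" "l < b"
proof -
  have "semi_dev \<Omega> f l / 2 \<in> semi_dev \<Omega> f ` I" "2 * semi_dev \<Omega> f l \<in> semi_dev \<Omega> f ` I"
    using l unfolding dev_range by auto
  then obtain a b where ab: "a \<in> I" "semi_dev \<Omega> f l / 2 = semi_dev \<Omega> f a"
      "b \<in> I" "2 * semi_dev \<Omega> f l = semi_dev \<Omega> f b"
    by (elim imageE)
  have "a < l"
    using strict_mono_on_less[OF dev_strict_mono ab(1) l(1)] ab(2) l(2) by linarith
  moreover have "l < b"
    using strict_mono_on_less[OF dev_strict_mono l(1) ab(3)] ab(4) l(2) by linarith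
  ultimately show thesis
    using that[OF ab(1,3)] ab(2) l(2) by linarith
qed

lemma eventually_in_interval:
  assumes "l \<in> I" "0 < semi_dev \<Omega> f l"
  shows "\<forall>\<^sub>F m in nhds l. m \<in> I"
proof -
  obtain a b where ab: "a \<in> I" "b \<in> I" "a < l" "l < b"
    using dev_interior[OF assms] by blast
  then have "\<forall>\<^sub>F m in nhds l. m \<in> {a<..<b}"
    by (intro eventually_nhds_in_open) auto
  then show ?thesis
    by eventually_elim (use segment_subset[OF ab(1,2)] in auto)
qed

lemma cdf_less:
  assumes "a \<in> I" "b \<in> I" "a < b" "0 < semi_dev \<Omega> f a" "x < \<Omega>"
  shows "cdf_at f a x < cdf_at f b x"
proof (rule DERIV_pos_imp_increasing[OF \<open>a < b\<close>])
  fix m assume m: "a \<le> m" "m \<le> b"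
  then have "m \<in> I"
    using segment_subset[OF assms(1,2)] by blast
  moreover have "0 < semi_dev \<Omega> f m"
    using assms(1,4) dev_less[OF assms(1) \<open>m \<in> I\<close>] m by (cases "a = m") auto
  ultimately show "\<exists>y. ((\<lambda>m. cdf_at f m x) has_real_derivative y) (at m) \<and> 0 < y"
    using cdf_increasing \<open>x < \<Omega>\<close> by blast
qed

text \<open>Markov's inequality: \<open>(\<Omega> - x) * cdf_at f a x\<close> is at most the
  semi-deviation. This covers the left endpoint of \<open>I\<close>, where
  \<open>cdf_increasing\<close> gives no information.\<close>

lemma cdf_eq_0:
  assumes a: "a \<in> I" "semi_dev \<Omega> f a = 0" and x: "x < \<Omega>"
  shows "cdf_at f a x = 0"
proof -
  have "(\<Omega> - x) * cdf_at f a x = (LBINT t:{..x}. (\<Omega> - x) * f a t)"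
    by (simp add: cdf_at_def)
  also have "\<dots> \<le> (LBINT t:{..\<Omega>}. (\<Omega> - t) * f a t)"
    unfolding set_lebesgue_integral_def
  proof (rule integral_mono)
    show "integrable lborel (\<lambda>t. indicator {..x} t *\<^sub>R ((\<Omega> - x) * f a t))"
      using density_set_integrable[OF a(1), of "{..x}"] set_integrable_mult_right
      unfolding set_integrable_def[symmetric] by auto
    show "integrable lborel (\<lambda>t. indicator {..\<Omega>} t *\<^sub>R ((\<Omega> - t) * f a t))"
      using dev_finite[OF a(1)] by (simp add: set_integrable_def)
    show "indicator {..x} t *\<^sub>R ((\<Omega> - x) * f a t) \<le> indicator {..\<Omega>} t *\<^sub>R ((\<Omega> - t) * f a t)" for t
      using density_nonneg[OF a(1), of t] x by (auto simp: indicator_def intro!: mult_right_mono)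
  qed
  also have "\<dots> = 0"
    using a by (simp add: semi_dev_def)
  finally have "cdf_at f a x \<le> 0"
    using x by (simp add: mult_le_0_iff)
  then show ?thesis
    using cdf_nonneg[OF a(1), of x] by simp
qed

lemma cdf_mono_param:
  assumes "a \<in> I" "b \<in> I" "a \<le> b" "x < \<Omega>"
  shows "cdf_at f a x \<le> cdf_at f b x"
proof (cases "a = b \<or> semi_dev \<Omega> f a = 0")
  case True
  then show ?thesis
    using assms cdf_eq_0 cdf_nonneg by auto
next
  case False
  then show ?thesis
    using cdf_less[of a b x] assms dev_nonneg[of a] by auto
qed

lemma int_cdf_mono_param:
  assumes "a \<in> I" "b \<in> I" "a \<le> b" "x < \<Omega>"
  shows "int_cdf f a x \<le> int_cdf f b x"
  unfolding int_cdf_def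
proof (rule set_integral_mono)
  show "set_integrable lborel {..x} (cdf_at f a)" "set_integrable lborel {..x} (cdf_at f b)"
    using assms by (auto intro: cdf_integrable)
  show "cdf_at f a t \<le> cdf_at f b t" if "t \<in> {..x}" for t
    using that assms by (auto intro!: cdf_mono_param)
qed

end

section \<open>Positivity of the transfer function\<close>

locale fragility_family_at = fragility_family +
  fixes l :: real
  assumes l: "l \<in> I" and dev_pos: "0 < semi_dev \<Omega> f l"
begin

definition dcdf :: "real \<Rightarrow> real" where
  "dcdf x = deriv (\<lambda>m. cdf_at f m x) l"

lemma
  assumes "x < \<Omega>"
  shows dcdf: "((\<lambda>m. cdf_at f m x) has_real_derivative dcdf x) (at l)"
    and dcdf_pos: "0 < dcdf x"
  using cdf_increasing[OF l dev_pos assms] by (auto simp: dcdf_def DERIV_imp_deriv)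

definition ddev :: real where
  "ddev = deriv (semi_dev \<Omega> f) l"

lemma ddev: "(semi_dev \<Omega> f has_real_derivative ddev) (at l)"
  using dev_differentiable[OF l dev_pos]
  by (simp add: ddev_def DERIV_deriv_iff_real_differentiable)

text \<open>Near \<open>l\<close> the shortfall is \<open>tail_shortfall\<close> composed with the
  semi-deviation, so this is the chain rule; joint differentiability applies because the point (K,
  s) is interior. The product form makes sense before \<open>ddev\<close> is known to be
  nonzero.\<close>

lemma shortfall_deriv_fragility:
  assumes "K < \<Omega>"
  shows "(shortfall K has_real_derivative fragility I \<Omega> f K (semi_dev \<Omega> f l) * ddev) (at l)"
proof -
  let ?s = "semi_dev \<Omega> f l"
  let ?S = "{..\<Omega>} \<times> {0..}"
  have int: "(K, ?s) \<in> interior ?S"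
    using assms dev_pos by (simp add: interior_Times)
  then have "(\<lambda>(K, s). tail_shortfall I \<Omega> f K s) differentiable (at (K, ?s) within ?S)"
    using shortfall_differentiable interior_subset[of ?S] unfolding differentiable_on_def by blast
  then have "(\<lambda>(K, s). tail_shortfall I \<Omega> f K s) differentiable (at (K, ?s))"
    using at_within_interior[OF int] by simp
  moreover have "(\<lambda>t. (K, t)) differentiable (at ?s)"
    by (auto simp: differentiable_def intro!: derivative_eq_intros)
  ultimately have "((\<lambda>(K, s). tail_shortfall I \<Omega> f K s) \<circ> (\<lambda>t. (K, t))) differentiable (at ?s)"
    by (intro differentiable_chain_at) auto
  then have "(tail_shortfall I \<Omega> f K has_real_derivative fragility I \<Omega> f K ?s) (at ?s)"
    by (simp add: o_def fragility_def DERIV_deriv_iff_real_differentiable)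
  from DERIV_chain2[OF this ddev]
  have "((\<lambda>m. tail_shortfall I \<Omega> f K (semi_dev \<Omega> f m)) has_real_derivative
      fragility I \<Omega> f K ?s * ddev) (at l)" .
  moreover have "\<forall>\<^sub>F m in nhds l. tail_shortfall I \<Omega> f K (semi_dev \<Omega> f m) = shortfall K m"
    using eventually_in_interval[OF l dev_pos]
    by eventually_elim
      (simp add: tail_shortfall_def shortfall_def dev_param_def the_inv_into_f_f[OF dev_inj])
  ultimately show ?thesis
    by (subst DERIV_cong_ev[OF refl _ refl, symmetric]) auto
qed

lemma int_cdf_deriv_fragility:
  assumes "x < \<Omega>"
  shows "((\<lambda>m. int_cdf f m x) has_real_derivative
      fragility I \<Omega> f x (semi_dev \<Omega> f l) * ddev - (\<Omega> - x) * dcdf x) (at l)"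
proof -
  have "((\<lambda>m. shortfall x m - (\<Omega> - x) * cdf_at f m x) has_real_derivative
      fragility I \<Omega> f x (semi_dev \<Omega> f l) * ddev - (\<Omega> - x) * dcdf x) (at l)"
    by (intro DERIV_diff shortfall_deriv_fragility DERIV_cmult dcdf assms)
  moreover have "\<forall>\<^sub>F m in nhds l. int_cdf f m x = shortfall x m - (\<Omega> - x) * cdf_at f m x"
    using eventually_in_interval[OF l dev_pos]
    by eventually_elim (use assms in \<open>simp add: int_cdf_eq\<close>)
  ultimately show ?thesis
    by (subst DERIV_cong_ev[OF refl _ refl]) auto
qed

lemma deriv_nonneg_of_mono:
  assumes mono: "\<And>m. m \<in> I \<Longrightarrow> l \<le> m \<Longrightarrow> g l \<le> g m"
    and deriv: "(g has_real_derivative d) (at l)"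
  shows "0 \<le> d"
proof (rule ccontr)
  assume "\<not> 0 \<le> d"
  then obtain e where e: "0 < e" "\<And>h. 0 < h \<Longrightarrow> h < e \<Longrightarrow> g (l + h) < g l"
    using DERIV_neg_dec_right[OF deriv] by (metis not_le)
  obtain b where b: "b \<in> I" "l < b"
    using dev_interior[OF l dev_pos] by blast
  define h where "h = min (e / 2) (b - l)"
  have "0 < h" "h < e" "l + h \<in> I"
    using e b segment_subset[OF l b(1), of "l + h"] by (auto simp: h_def)
  then show False
    using e(2)[of h] mono[of "l + h"] by auto
qed

text \<open>Monotonicity gives \<open>ddev\<close> \<ge> 0. If \<open>ddev\<close> were 0, the
  derivative of \<open>int_cdf\<close> at a point below \<Omega> would reduce to
  \<open>- (\<Omega> - x) * dcdf x\<close>, which is negative, although \<open>int_cdf\<close>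
  increases with the parameter.\<close>

lemma ddev_pos: "0 < ddev"
proof -
  have "0 \<le> ddev"
    using ddev
  proof (rule deriv_nonneg_of_mono[rotated])
    show "semi_dev \<Omega> f l \<le> semi_dev \<Omega> f m" if "m \<in> I" "l \<le> m" for m
      using dev_less[OF l that(1)] that by (cases "l = m") auto
  qed
  moreover
  let ?x = "\<Omega> - 1"
  have "0 \<le> fragility I \<Omega> f ?x (semi_dev \<Omega> f l) * ddev - (\<Omega> - ?x) * dcdf ?x"
    using int_cdf_deriv_fragility
    by (rule deriv_nonneg_of_mono[rotated]) (use l int_cdf_mono_param in auto)
  then have "ddev \<noteq> 0"
    using dcdf_pos[of ?x] by auto
  ultimately show ?thesis by simp
qed

section \<open>Vega and the integrated derivative of the distribution function\<close>

definition vega :: "real \<Rightarrow> real" where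
  "vega K = (LBINT x:{..K}. (\<Omega> - x) * deriv (\<lambda>m. f m x) l)"

lemma fragility_eq: "K < \<Omega> \<Longrightarrow> fragility I \<Omega> f K (semi_dev \<Omega> f l) = vega K / ddev"
  using vega_formula[OF l dev_pos] by (simp add: vega_def ddev_def divide_inverse)

lemma shortfall_deriv: "K < \<Omega> \<Longrightarrow> (shortfall K has_real_derivative vega K) (at l)"
  using shortfall_deriv_fragility ddev_pos by (simp add: fragility_eq)

text \<open>Integration by parts with weight 1 for the parameter derivative \<open>?h\<close> of the
  density, whose running integral is \<open>dcdf\<close> by \<open>cdf_deriv\<close>. Integrability
  of \<open>?h\<close> itself comes from that of \<open>(\<Omega> - t) * ?h t\<close>, since
  \<Omega> - t stays above \<Omega> - x > 0 on the half-line.\<close>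

lemma
  assumes x: "x < \<Omega>"
  shows dcdf_integrable: "set_integrable lborel {..x} dcdf"
    and vega_eq: "vega x = (LBINT t:{..x}. dcdf t) + (\<Omega> - x) * dcdf x"
proof -
  let ?h = "\<lambda>t. deriv (\<lambda>m. f m t) l"
  have hx: "set_integrable lborel {..x} (\<lambda>t. (\<Omega> - t) * ?h t)"
    using vega_integrable[OF l dev_pos x] .
  have h: "set_integrable lborel {..x} ?h"
  proof (rule set_integrable_bound)
    show "set_integrable lborel {..x} (\<lambda>t. inverse (\<Omega> - x) * ((\<Omega> - t) * ?h t))"
      using hx by simp
    have [measurable]: "(\<lambda>t. indicator {..x} t * ((\<Omega> - t) * ?h t)) \<in> borel_measurable borel"
      using hx by (simp add: set_integrable_def)
    have "(\<lambda>t. inverse (\<Omega> - t) * (indicator {..x} t * ((\<Omega> - t) * ?h t))) \<in> borel_measurable borel"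
      by measurable
    also have "(\<lambda>t. inverse (\<Omega> - t) * (indicator {..x} t * ((\<Omega> - t) * ?h t)))
        = (\<lambda>t. indicator {..x} t * ?h t)"
      using x by (auto simp: indicator_def fun_eq_iff)
    finally show "set_borel_measurable lborel {..x} ?h"
      by (simp add: set_borel_measurable_def)
    show "AE t in lborel. t \<in> {..x} \<longrightarrow> norm (?h t) \<le> norm (inverse (\<Omega> - x) * ((\<Omega> - t) * ?h t))"
    proof (intro AE_I2 impI)
      fix t assume "t \<in> {..x}"
      then have "1 \<le> (\<Omega> - t) / (\<Omega> - x)"
        using x by (simp add: field_simps)
      from mult_right_mono[OF this, of "\<bar>?h t\<bar>"]
      show "norm (?h t) \<le> norm (inverse (\<Omega> - x) * ((\<Omega> - t) * ?h t))"
        using x \<open>t \<in> {..x}\<close> by (simp add: abs_mult divide_inverse mult_ac)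
    qed
  qed
  have hx': "set_integrable lborel {..x} (\<lambda>t. (x - t) * ?h t)"
    using set_integral_diff(1)[OF hx set_integrable_mult_right[OF h, of "\<Omega> - x"]]
    by (simp add: algebra_simps)
  note parts = tail_integral_by_parts[of "\<lambda>_. 1" x "\<lambda>t. t" ?h, OF _ _ _ h hx']
  have D: "dcdf t = (LBINT u:{..t}. ?h u)" if "t \<le> x" for t
    using cdf_deriv[OF l dev_pos] that x by (simp add: dcdf_def)
  show "set_integrable lborel {..x} dcdf"
    by (rule set_integrable_cong[THEN iffD1, rotated -1, OF parts(1)]) (auto simp: D)
  have "(LBINT t:{..x}. dcdf t) = (LBINT t:{..x}. (x - t) * ?h t)"
    using parts(2) by (subst set_lebesgue_integral_cong[where g = "\<lambda>t. LBINT u:{..t}. ?h u"]) (auto simp: D)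
  also have "\<dots> = (LBINT t:{..x}. (\<Omega> - t) * ?h t - (\<Omega> - x) * ?h t)"
    by (simp add: algebra_simps)
  also have "\<dots> = vega x - (\<Omega> - x) * dcdf x"
    using h hx by (subst set_integral_diff(2)) (auto simp: vega_def D)
  finally show "vega x = (LBINT t:{..x}. dcdf t) + (\<Omega> - x) * dcdf x" by simp
qed

definition dint :: "real \<Rightarrow> real" where
  "dint x = (LBINT t:{..x}. dcdf t)"

text \<open>Differentiation under the integral sign without domination: the derivative already found
  is \<open>vega x - (\<Omega> - x) * dcdf x\<close>, and \<open>vega_eq\<close> says that this is
  \<open>dint x\<close>.\<close>

lemma int_cdf_deriv: "x < \<Omega> \<Longrightarrow> ((\<lambda>m. int_cdf f m x) has_real_derivative dint x) (at l)"
  using int_cdf_deriv_fragility[of x] ddev_pos by (simp add: fragility_eq vega_eq dint_def)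

lemma int_cdf_deriv_Omega: "((\<lambda>m. int_cdf f m \<Omega>) has_real_derivative ddev) (at l)"
proof -
  have "\<forall>\<^sub>F m in nhds l. int_cdf f m \<Omega> = semi_dev \<Omega> f m"
    using eventually_in_interval[OF l dev_pos] by eventually_elim (rule int_cdf_Omega)
  then show ?thesis
    using ddev by (subst DERIV_cong_ev[OF refl _ refl]) auto
qed

lemma int_stopped_cdf_deriv:
  assumes "K < \<Omega>" "K \<le> x"
  shows "((\<lambda>m. int_stopped_cdf f K m x) has_real_derivative dint K + (x - K) * dcdf K) (at l)"
proof -
  have "\<forall>\<^sub>F m in nhds l. int_stopped_cdf f K m x = int_cdf f m K + (x - K) * cdf_at f m K"
    using eventually_in_interval[OF l dev_pos]
    by eventually_elim (use assms in \<open>auto intro: int_stopped_cdf_above\<close>)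
  moreover have "((\<lambda>m. int_cdf f m K + (x - K) * cdf_at f m K) has_real_derivative
      dint K + (x - K) * dcdf K) (at l)"
    by (intro DERIV_add int_cdf_deriv DERIV_cmult dcdf assms)
  ultimately show ?thesis
    by (subst DERIV_cong_ev[OF refl _ refl]) auto
qed

text \<open>The denominators of the transfer function are \<open>ddev\<close> and
  \<open>dint K + (\<Omega> - K) * dcdf K\<close>; the latter is \<open>vega K\<close> by
  \<open>vega_eq\<close>.\<close>

lemma transfer_fn_below:
  assumes "K < \<Omega>" "x \<le> K"
  shows "transfer_fn \<Omega> f K l x = dint x / vega K - dint x / ddev"
  using assms int_cdf_deriv[of x] int_cdf_deriv_Omega int_stopped_cdf_deriv[of K \<Omega>]
  by (simp add: transfer_fn_def int_stopped_cdf_below DERIV_imp_deriv vega_eq dint_def)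

lemma transfer_fn_above:
  assumes "K \<le> x" "x < \<Omega>"
  shows "transfer_fn \<Omega> f K l x = (dint K + (x - K) * dcdf K) / vega K - dint x / ddev"
  using assms int_cdf_deriv[of x] int_cdf_deriv_Omega int_stopped_cdf_deriv[of K \<Omega>]
    int_stopped_cdf_deriv[of K x]
  by (simp add: transfer_fn_def DERIV_imp_deriv vega_eq dint_def)

lemma dint_pos: "x < \<Omega> \<Longrightarrow> 0 < dint x"
  unfolding dint_def
  by (rule set_integral_pos[where B = "{x - 1..x}"])
    (auto intro: dcdf_integrable less_imp_le[OF dcdf_pos] dcdf_pos)

lemma vega_pos: "K < \<Omega> \<Longrightarrow> 0 < vega K"
  using dint_pos[of K] dcdf_pos[of K] by (simp add: vega_eq dint_def add_pos_pos)

lemma dint_split: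
  assumes "K \<le> x" "x < \<Omega>"
  shows "dcdf integrable_on {K..x}" "integral {K..x} dcdf = dint x - dint K"
proof -
  have i: "set_integrable lborel {K..x} dcdf"
    by (rule set_integrable_subset[OF dcdf_integrable[of x]]) (use assms in auto)
  show "dcdf integrable_on {K..x}"
    using set_borel_integral_eq_integral(1)[OF i] .
  show "integral {K..x} dcdf = dint x - dint K"
    using set_borel_integral_eq_integral(2)[OF i]
      set_integral_split_Iic[OF dcdf_integrable assms(1)] assms
    by (simp add: dint_def)
qed

lemma vega_tendsto_0: "(vega \<longlongrightarrow> 0) at_bot"
proof -
  let ?h = "\<lambda>x. (\<Omega> - x) * deriv (\<lambda>m. f m x) l"
  let ?b = "\<Omega> - 1"
  have i: "set_integrable lborel {..?b} ?h"
    using vega_integrable[OF l dev_pos, of ?b] by simp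
  then have "((\<lambda>a. LBINT x:{a..?b}. ?h x) \<longlongrightarrow> vega ?b) at_bot"
    unfolding vega_def by (intro tendsto_set_lebesgue_integral_at_bot) auto
  then have "((\<lambda>a. vega ?b - (LBINT x:{a..?b}. ?h x)) \<longlongrightarrow> vega ?b - vega ?b) at_bot"
    by (intro tendsto_diff tendsto_const)
  moreover have "\<forall>\<^sub>F a in at_bot. vega ?b - (LBINT x:{a..?b}. ?h x) = vega a"
    using eventually_le_at_bot[of ?b]
    by eventually_elim (use set_integral_split_Iic[OF i] in \<open>auto simp: vega_def\<close>)
  ultimately show ?thesis
    by (simp add: filterlim_cong)
qed

lemma threshold_exists:
  obtains \<Theta> where "\<Theta> < \<Omega>" "\<And>K. K \<le> \<Theta> \<Longrightarrow> vega K < ddev"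
proof -
  obtain N where "\<And>K. K \<le> N \<Longrightarrow> vega K < ddev"
    using order_tendstoD(2)[OF vega_tendsto_0 ddev_pos] by (auto simp: eventually_at_bot_linorder)
  then show thesis
    by (intro that[of "min N (\<Omega> - 1)"]) auto
qed

text \<open>Up to \<open>K\<close> the transfer function is \<open>dint x\<close> times
  1/\<open>vega K\<close> - 1/\<open>ddev\<close>, hence positive. Its continuity to the right of
  \<open>K\<close> extends positivity a little further.\<close>

lemma transfer_fn_pos_range:
  assumes K: "K < \<Omega>" and less: "vega K < ddev"
  obtains \<kappa> where "K < \<kappa>" "\<kappa> < \<Omega>" "\<And>x. x \<le> \<kappa> \<Longrightarrow> 0 < transfer_fn \<Omega> f K l x"
proof -
  have vp: "0 < vega K" by (rule vega_pos[OF K])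
  have below: "0 < transfer_fn \<Omega> f K l x" if "x \<le> K" for x
    using that K less vp dint_pos[of x] by (auto simp: transfer_fn_below intro!: divide_strict_left_mono)
  let ?b = "(K + \<Omega>) / 2"
  let ?H = "\<lambda>x. (dint K + (x - K) * dcdf K) / vega K - (dint K + integral {K..x} dcdf) / ddev"
  have b: "K < ?b" "?b < \<Omega>"
    using K by auto
  have "continuous_on {K..?b} (\<lambda>x. integral {K..x} dcdf)"
    using b by (intro indefinite_integral_continuous_1 dint_split) auto
  then have cont: "continuous_on {K..?b} ?H"
    using vp ddev_pos by (intro continuous_intros) auto
  have H: "?H x = transfer_fn \<Omega> f K l x" if "K \<le> x" "x \<le> ?b" for x
    using that b by (simp add: transfer_fn_above dint_split)
  have "K \<in> {K..?b}"
    using b by simp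
  with cont have "(?H \<longlongrightarrow> ?H K) (at K within {K..?b})"
    unfolding continuous_on by (rule bspec)
  moreover have "0 < ?H K"
    using H[of K] below[of K] b by simp
  ultimately have "\<forall>\<^sub>F x in at K within {K..?b}. 0 < ?H x"
    by (rule order_tendstoD)
  then obtain d where d: "0 < d" "\<And>x. x \<in> {K..?b} \<Longrightarrow> x \<noteq> K \<Longrightarrow> dist x K < d \<Longrightarrow> 0 < ?H x"
    by (auto simp: eventually_at)
  \<comment> \<open>The midpoint \<open>?b\<close> keeps \<kappa> below \<Omega>; half of
    \<open>d\<close> keeps it strictly inside the neighbourhood where \<open>?H\<close> is
    positive.\<close>
  define \<kappa> where "\<kappa> = min ?b (K + d / 2)"
  show thesis
  proof (rule that)
    show "K < \<kappa>" "\<kappa> < \<Omega>"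
      using b d(1) unfolding \<kappa>_def by linarith+
    fix x assume x: "x \<le> \<kappa>"
    show "0 < transfer_fn \<Omega> f K l x"
    proof (cases "x \<le> K")
      case False
      then have "K \<le> x" "x \<le> ?b" "dist x K < d"
        using x d by (auto simp: \<kappa>_def dist_real_def)
      then show ?thesis
        using d(2)[of x] H[of x] False by auto
    qed (rule below)
  qed
qed

end

section \<open>Comparison of the sensitivities\<close>

text \<open>The data that a change of variable contributes: \<open>w_antimono\<close> carries
  concavity, \<open>w_\<kappa>\<close> the matching of slopes at \<kappa>, \<open>w_nonzero\<close>
  the failure of \<phi> to be affine, and \<open>\<psi>_integrable\<close> the finiteness of the
  semi-deviations of Y.\<close>

locale concave_stress = fragility_family_at +
  fixes K \<kappa> a :: real and \<psi> w :: "real \<Rightarrow> real"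
  assumes K_less: "K < \<kappa>" and \<kappa>_less: "\<kappa> < \<Omega>"
    and vega_less: "vega K < ddev"
    and transfer_pos: "\<And>x. x \<le> \<kappa> \<Longrightarrow> 0 < transfer_fn \<Omega> f K l x"
    and a_pos: "0 < a"
    and w_measurable [measurable]: "w \<in> borel_measurable borel"
    and \<psi>_deriv: "\<And>x. (\<psi> has_real_derivative w x) (at x)"
    and w_antimono: "\<And>x y. x \<le> y \<Longrightarrow> y \<le> \<kappa> \<Longrightarrow> w y \<le> w x"
    and w_\<kappa>: "w \<kappa> = 0"
    and w_nonzero: "\<exists>x\<le>\<kappa>. w x \<noteq> 0"
    and \<psi>_integrable: "\<And>m. m \<in> I \<Longrightarrow> set_integrable lborel {..\<kappa>} (\<lambda>x. (\<psi> \<kappa> - \<psi> x) * f m x)"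
begin

lemma w_nonneg: "x \<le> \<kappa> \<Longrightarrow> 0 \<le> w x"
  using w_antimono[of x \<kappa>] w_\<kappa> by simp

lemma K_less_\<Omega>: "K < \<Omega>"
  using K_less \<kappa>_less by simp

text \<open>This is the fragility of X at \<open>K\<close>, by \<open>fragility_eq\<close>.\<close>

definition level :: real where
  "level = vega K / ddev"

lemma level_bounds: "0 < level" "level < 1" "level * ddev = vega K"
  using vega_pos[OF K_less_\<Omega>] vega_less ddev_pos by (auto simp: level_def)

text \<open>The weight \<open>w\<close> may be unbounded near minus infinity, where the derivatives of the
  distribution functions need not be \<open>w\<close>-integrable; truncation suffices for a lower bound.\<close>

definition trunc :: "real \<Rightarrow> real" where
  "trunc x = min (w x) (w K + 1)"

lemma trunc_measurable [measurable]: "trunc \<in> borel_measurable borel"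
  unfolding trunc_def[abs_def] by measurable

lemma trunc_bound: "x \<le> K \<Longrightarrow> \<bar>trunc x\<bar> \<le> w K + 1"
  using w_nonneg[of x] w_nonneg[of K] K_less by (auto simp: trunc_def)

lemma w_bound: "x \<in> {K..\<kappa>} \<Longrightarrow> \<bar>w x\<bar> \<le> w K"
  using w_nonneg[of x] w_antimono[of K x] by auto

lemma dcdf_integrable_Icc: "set_integrable lborel {K..\<kappa>} dcdf"
  by (rule set_integrable_subset[OF dcdf_integrable[OF \<kappa>_less]]) auto

text \<open>The left side is the integral over \<open>{K..\<kappa>}\<close> of \<open>w\<close>
  times \<open>?g\<close>. The second mean value theorem applies to the increasing function -w, and
  its boundary term at \<kappa> vanishes because \<open>w \<kappa>\<close> = 0.\<close>

lemma mean_value: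
  obtains c where "K \<le> c" "c \<le> \<kappa>"
    "(\<psi> \<kappa> - \<psi> K) * dcdf K - level * (LBINT x:{K..\<kappa>}. w x * dcdf x)
       = w K * ((c - K) * dcdf K - level * (dint c - dint K))"
proof -
  let ?g = "\<lambda>x. dcdf K - level * dcdf x"
  have D: "dcdf integrable_on {K..\<kappa>}"
    using dint_split(1)[of K \<kappa>] K_less \<kappa>_less by simp
  have g: "?g integrable_on {K..\<kappa>}"
    using integrable_cmul[OF D, of level] by (intro integrable_diff) auto
  obtain c where c: "c \<in> {K..\<kappa>}"
    "integral {K..\<kappa>} (\<lambda>x. - w x * ?g x) = - w K * integral {K..c} ?g + - w \<kappa> * integral {c..\<kappa>} ?g"
  proof (rule second_mean_value_theorem[OF g])
    show "- w x \<le> - w y" if "K \<le> x" "x \<le> y" "y \<le> \<kappa>" for x y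
      using w_antimono[of x y] that by simp
  qed (use K_less in auto)
  have gc: "integral {K..c} ?g = (c - K) * dcdf K - level * (dint c - dint K)"
  proof -
    have "dcdf integrable_on {K..c}" "integral {K..c} dcdf = dint c - dint K"
      using dint_split[of K c] c(1) \<kappa>_less by auto
    then show ?thesis
      using c(1) integrable_cmul[of dcdf "{K..c}" level]
      by (subst Henstock_Kurzweil_Integration.integral_diff) auto
  qed
  have wD: "set_integrable lborel {K..\<kappa>} (\<lambda>x. w x * dcdf x)"
    by (rule set_integrable_mult_bounded[OF dcdf_integrable_Icc _ w_bound]) auto
  have w_int: "(w has_integral \<psi> \<kappa> - \<psi> K) {K..\<kappa>}"
    using K_less \<psi>_deriv
    by (intro fundamental_theorem_of_calculus)
      (auto simp: has_real_derivative_iff_has_vector_derivative[symmetric]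
        intro: has_field_derivative_at_within)
  have "((\<lambda>x. w x * dcdf K - level * (w x * dcdf x)) has_integral
      (\<psi> \<kappa> - \<psi> K) * dcdf K - level * (LBINT x:{K..\<kappa>}. w x * dcdf x)) {K..\<kappa>}"
    using set_borel_integral_eq_integral[OF wD]
    by (intro has_integral_diff has_integral_mult_left has_integral_mult_right w_int)
      (auto simp: has_integral_iff)
  then have "(\<psi> \<kappa> - \<psi> K) * dcdf K - level * (LBINT x:{K..\<kappa>}. w x * dcdf x)
      = integral {K..\<kappa>} (\<lambda>x. w x * dcdf K - level * (w x * dcdf x))"
    by (simp add: integral_unique)
  also have "\<dots> = - integral {K..\<kappa>} (\<lambda>x. - w x * ?g x)"
    by (simp add: algebra_simps flip: Henstock_Kurzweil_Integration.integral_neg)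
  also have "\<dots> = w K * ((c - K) * dcdf K - level * (dint c - dint K))"
    unfolding c(2) gc w_\<kappa> by simp
  finally show thesis
    using that c(1) by auto
qed

text \<open>A lower bound, in the limit, for the \<open>Z\<close>-quotient minus
  \<open>level\<close> times the \<open>u\<close>-quotient. The terms with \<open>a\<close> are
  absent because \<open>level * ddev\<close> = \<open>vega K\<close>.\<close>

definition gap :: real where
  "gap = (1 - level) * (LBINT x:{..K}. trunc x * dcdf x)
     + (\<psi> \<kappa> - \<psi> K) * dcdf K - level * (LBINT x:{K..\<kappa>}. w x * dcdf x)"

lemma gap_pos: "0 < gap"
proof -
  obtain c where c: "K \<le> c" "c \<le> \<kappa>"
    "(\<psi> \<kappa> - \<psi> K) * dcdf K - level * (LBINT x:{K..\<kappa>}. w x * dcdf x)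
       = w K * ((c - K) * dcdf K - level * (dint c - dint K))"
    by (rule mean_value)
  have vp: "0 < vega K"
    by (rule vega_pos[OF K_less_\<Omega>])
  \<comment> \<open>Only positivity of the transfer function at the mean value point
    \<open>c\<close> enters.\<close>
  have "0 < transfer_fn \<Omega> f K l c * vega K"
    using transfer_pos[OF c(2)] vp by simp
  also have "\<dots> = dint K + (c - K) * dcdf K - level * dint c"
    using c \<kappa>_less vp by (simp add: transfer_fn_above level_def left_diff_distrib)
  finally have H: "0 < dint K + (c - K) * dcdf K - level * dint c" .
  have ti: "set_integrable lborel {..K} (\<lambda>x. trunc x * dcdf x)"
    by (rule set_integrable_mult_bounded[OF dcdf_integrable[OF K_less_\<Omega>] _ trunc_bound]) auto
  have gap: "gap = (1 - level) * (LBINT x:{..K}. trunc x * dcdf x)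
      + w K * ((c - K) * dcdf K - level * (dint c - dint K))"
    using c(3) by (simp add: gap_def)
  show ?thesis
  proof (cases "w K = 0")
    case True
    obtain x0 where x0: "x0 \<le> \<kappa>" "w x0 \<noteq> 0"
      using w_nonzero by blast
    \<comment> \<open>Here the mean value term vanishes, so the integral over \<open>{..K}\<close>
      must be strictly positive. Monotonicity makes \<open>w\<close> positive on
      \<open>{..b}\<close>, and the truncation height \<open>w K + 1\<close> is 1, so
      \<open>trunc\<close> is positive there too.\<close>
    define b where "b = min x0 K"
    have pos: "0 < trunc x" if "x \<le> b" for x
      using w_antimono[of x x0] w_nonneg[OF x0(1)] x0 that True
      by (auto simp: trunc_def b_def)
    have "0 < (LBINT x:{..K}. trunc x * dcdf x)"
    proof (rule set_integral_pos[OF ti, where B = "{b - 1..b}"])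
      show "0 \<le> trunc x * dcdf x" if "x \<in> {..K}" for x
        using that K_less K_less_\<Omega> w_nonneg[of x] w_nonneg[of K] dcdf_pos[of x]
        by (auto simp: trunc_def intro!: mult_nonneg_nonneg)
      show "0 < trunc x * dcdf x" if "x \<in> {b - 1..b}" for x
        using that pos[of x] dcdf_pos[of x] K_less_\<Omega> by (auto simp: b_def)
      show "emeasure lborel {b - 1..b} \<noteq> 0"
        by simp
    qed (auto simp: b_def)
    then show ?thesis
      using level_bounds by (simp add: gap True)
  next
    case False
    then have wK: "0 < w K"
      using w_nonneg[of K] K_less by simp
    \<comment> \<open>On \<open>{..K}\<close> both \<open>w\<close> and the truncation height are at
      least \<open>w K\<close>, so \<open>gap\<close> is bounded below by \<open>w K\<close> times
      the positive quantity \<open>H\<close>.\<close>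
    have "w K * dint K = (LBINT x:{..K}. w K * dcdf x)"
      by (simp add: dint_def)
    also have "\<dots> \<le> (LBINT x:{..K}. trunc x * dcdf x)"
    proof (rule set_integral_mono)
      show "w K * dcdf x \<le> trunc x * dcdf x" if "x \<in> {..K}" for x
        using that w_antimono[of x K] K_less dcdf_pos[of x] K_less_\<Omega>
        by (auto simp: trunc_def intro!: mult_right_mono)
    qed (use ti dcdf_integrable[OF K_less_\<Omega>] in auto)
    finally have "(1 - level) * (w K * dint K) \<le> (1 - level) * (LBINT x:{..K}. trunc x * dcdf x)"
      using level_bounds by (intro mult_left_mono) auto
    moreover have "(1 - level) * (w K * dint K) + w K * ((c - K) * dcdf K - level * (dint c - dint K))
        = w K * (dint K + (c - K) * dcdf K - level * dint c)"
      by (simp add: algebra_simps)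
    moreover have "0 < \<dots>"
      using wK H by simp
    ultimately show ?thesis
      by (simp add: gap)
  qed
qed

section \<open>Semi-deviation and shortfall of Y as functions of the parameter\<close>

lemma weighted_cdf_integrable:
  assumes "m \<in> I" "x \<le> \<kappa>"
  shows "set_integrable lborel {..x} (\<lambda>t. w t * cdf_at f m t)"
proof -
  have "set_integrable lborel {..\<kappa>} (\<lambda>t. w t * cdf_at f m t)"
    using tail_integral_by_parts(1)[OF w_measurable \<psi>_deriv w_nonneg
        density_set_integrable[OF assms(1)] \<psi>_integrable[OF assms(1)]]
    by (simp add: cdf_at_def)
  then show ?thesis
    by (rule set_integrable_subset) (use assms in auto)
qed

lemma weighted_cdf_parts:
  assumes m: "m \<in> I" and x: "x \<le> \<kappa>"
  shows "set_integrable lborel {..x} (\<lambda>t. (\<psi> x - \<psi> t) * f m t)"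
    and "(LBINT t:{..x}. (\<psi> x - \<psi> t) * f m t) = (LBINT t:{..x}. w t * cdf_at f m t)"
proof -
  have f: "set_integrable lborel {..x} (f m)"
    using m by (auto intro: density_set_integrable)
  have "set_integrable lborel {..x} (\<lambda>t. (\<psi> \<kappa> - \<psi> t) * f m t)"
    by (rule set_integrable_subset[OF \<psi>_integrable[OF m]]) (use x in auto)
  from set_integral_diff(1)[OF this set_integrable_mult_right[OF f, of "\<psi> \<kappa> - \<psi> x"]]
  show i: "set_integrable lborel {..x} (\<lambda>t. (\<psi> x - \<psi> t) * f m t)"
    by (simp add: algebra_simps)
  show "(LBINT t:{..x}. (\<psi> x - \<psi> t) * f m t) = (LBINT t:{..x}. w t * cdf_at f m t)"
    using tail_integral_by_parts(2)[OF w_measurable \<psi>_deriv _ f i] w_nonneg x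
    by (simp add: cdf_at_def)
qed

text \<open>With \<open>\<psi> x = \<phi> x - a * x\<close>, where \<open>a\<close> is the slope of \<open>\<phi>\<close> on \<open>{\<kappa>..\<Omega>}\<close>, these are the
  semi-deviation of \<open>Y\<close> and its tail shortfall at \<open>\<phi> K\<close>, as functions of the parameter.\<close>

definition u :: "real \<Rightarrow> real" where
  "u m = a * semi_dev \<Omega> f m + (LBINT t:{..\<kappa>}. w t * cdf_at f m t)"

definition Z :: "real \<Rightarrow> real" where
  "Z m = a * shortfall K m + (\<psi> \<kappa> - \<psi> K) * cdf_at f m K + (LBINT t:{..K}. w t * cdf_at f m t)"

text \<open>Makes the semi-deviation of Y invertible in the parameter and the difference quotients
  of \<open>u\<close> positive.\<close>

lemma u_less:
  assumes "m \<in> I" "m' \<in> I" "m < m'"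
  shows "u m < u m'"
proof -
  have "(LBINT t:{..\<kappa>}. w t * cdf_at f m t) \<le> (LBINT t:{..\<kappa>}. w t * cdf_at f m' t)"
    by (rule set_integral_mono[OF weighted_cdf_integrable weighted_cdf_integrable])
      (use assms \<kappa>_less in \<open>auto intro!: mult_left_mono cdf_mono_param w_nonneg\<close>)
  moreover have "a * semi_dev \<Omega> f m < a * semi_dev \<Omega> f m'"
    using dev_less[OF assms] a_pos by simp
  ultimately show ?thesis
    by (simp add: u_def)
qed

lemma u_inj: "inj_on u I"
  by (intro linorder_inj_onI' less_imp_neq u_less)

end

section \<open>Difference quotients along a sequence of parameters\<close>

context fragility_family_at
begin

text \<open>Approaching from above and below a fixed \<open>b\<close> in \<open>I\<close> lets the
  distribution function at \<open>b\<close> dominate all those along the sequence.\<close>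

lemma approach_sequence:
  obtains s b where "b \<in> I" "\<And>n. s n \<in> I" "\<And>n. l < s n" "\<And>n. s n \<le> b" "s \<longlonglongrightarrow> l"
proof -
  obtain b where b: "b \<in> I" "l < b"
    using dev_interior[OF l dev_pos] by blast
  define s where "s n = l + (b - l) * inverse (real (Suc n))" for n
  have "s \<longlonglongrightarrow> l + (b - l) * 0"
    unfolding s_def[abs_def]
    by (intro tendsto_intros LIMSEQ_inverse_real_of_nat)
  moreover have less: "l < s n" for n
    using b by (simp add: s_def)
  moreover have le: "s n \<le> b" for n
  proof -
    have "inverse (real (Suc n)) \<le> 1"
      by (simp add: inverse_eq_divide)
    then have "(b - l) * inverse (real (Suc n)) \<le> (b - l) * 1"
      using b by (intro mult_left_mono) auto
    then show ?thesis
      by (simp add: s_def)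
  qed
  moreover have "s n \<in> I" for n
    by (rule segment_subset[OF l b(1)]) (use less[of n] le[of n] in auto)
  ultimately show thesis
    using that[of b s] b(1) by simp
qed

end

context concave_stress
begin

lemma u_tendsto:
  assumes b: "b \<in> I" and s: "\<And>n. s n \<in> I" "\<And>n. l < s n" "\<And>n. s n \<le> b" "s \<longlonglongrightarrow> l"
  shows "(\<lambda>n. u (s n)) \<longlonglongrightarrow> u l"
proof -
  have "(\<lambda>n. semi_dev \<Omega> f (s n)) \<longlonglongrightarrow> semi_dev \<Omega> f l"
    by (rule isCont_tendsto_compose[OF DERIV_isCont[OF ddev] s(4)])
  moreover have "(\<lambda>n. LBINT t:{..\<kappa>}. w t * cdf_at f (s n) t) \<longlonglongrightarrow> (LBINT t:{..\<kappa>}. w t * cdf_at f l t)"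
    unfolding set_lebesgue_integral_def
  proof (rule integral_dominated_convergence)
    show "integrable lborel (\<lambda>t. indicator {..\<kappa>} t *\<^sub>R (w t * cdf_at f b t))"
      using weighted_cdf_integrable[OF b order_refl] by (simp add: set_integrable_def)
    show "(\<lambda>t. indicator {..\<kappa>} t *\<^sub>R (w t * cdf_at f l t)) \<in> borel_measurable lborel"
      using weighted_cdf_integrable[OF l order_refl] by (simp add: set_integrable_def)
    show "(\<lambda>t. indicator {..\<kappa>} t *\<^sub>R (w t * cdf_at f (s n) t)) \<in> borel_measurable lborel" for n
      using weighted_cdf_integrable[OF s(1) order_refl, of n] by (simp add: set_integrable_def)
    show "AE t in lborel. (\<lambda>n. indicator {..\<kappa>} t *\<^sub>R (w t * cdf_at f (s n) t))
        \<longlonglongrightarrow> indicator {..\<kappa>} t *\<^sub>R (w t * cdf_at f l t)"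
    proof (rule AE_I2)
      fix t
      show "(\<lambda>n. indicator {..\<kappa>} t *\<^sub>R (w t * cdf_at f (s n) t))
        \<longlonglongrightarrow> indicator {..\<kappa>} t *\<^sub>R (w t * cdf_at f l t)"
      proof (cases "t \<le> \<kappa>")
        case True
        then have "(\<lambda>n. cdf_at f (s n) t) \<longlonglongrightarrow> cdf_at f l t"
          using \<kappa>_less isCont_tendsto_compose[OF DERIV_isCont[OF dcdf] s(4)] by simp
        then show ?thesis
          by (intro tendsto_intros)
      qed simp
    qed
    show "AE t in lborel. norm (indicator {..\<kappa>} t *\<^sub>R (w t * cdf_at f (s n) t))
        \<le> indicator {..\<kappa>} t *\<^sub>R (w t * cdf_at f b t)" for n
    proof (rule AE_I2)
      fix t
      show "norm (indicator {..\<kappa>} t *\<^sub>R (w t * cdf_at f (s n) t))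
        \<le> indicator {..\<kappa>} t *\<^sub>R (w t * cdf_at f b t)"
        using w_nonneg[of t] cdf_nonneg[OF s(1), of n t] \<kappa>_less
          cdf_mono_param[OF s(1) b s(3), of t n]
        by (auto simp: indicator_def abs_mult intro!: mult_left_mono)
    qed
  qed
  ultimately show ?thesis
    unfolding u_def by (intro tendsto_intros)
qed

text \<open>Nothing ensures that \<open>u\<close> is differentiable at \<open>l\<close>, so only difference quotients of \<open>u\<close>
  and \<open>Z\<close> along a sequence are compared. Their possibly unbounded common part, the integral over
  \<open>{..K}\<close>, is controlled by averaging two lower bounds for \<open>Z\<close>-quotients, one with slope
  \<open>level\<close> and one with slope \<open>1\<close>.\<close>

lemma level_less_deriv:
  assumes \<zeta>: "(\<zeta> has_real_derivative W) (at (u l))" and \<zeta>_u: "\<And>m. m \<in> I \<Longrightarrow> \<zeta> (u m) = Z m"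
  shows "level < W"
proof -
  obtain s b where b: "b \<in> I" and s: "\<And>n. s n \<in> I" "\<And>n. l < s n" "\<And>n. s n \<le> b" "s \<longlonglongrightarrow> l"
    by (rule approach_sequence) blast
  have ne: "s n \<noteq> l" for n
    using s(2)[of n] by simp
  define q where "q g n = (g (s n) - g l) / (s n - l)" for g :: "real \<Rightarrow> real" and n
  note q_tendsto = quotient_tendsto[OF _ s(4) ne, folded q_def]
  define F where "F n x = q (\<lambda>m. cdf_at f m x) n" for n x
  have F_nonneg: "0 \<le> F n x" if "x < \<Omega>" for n x
    using cdf_mono_param[OF l s(1) _ that, of n] s(2)[of n] by (simp add: F_def q_def)
  have F_lim: "(\<lambda>n. F n x) \<longlonglongrightarrow> dcdf x" if "x < \<Omega>" for x
    unfolding F_def by (rule q_tendsto[OF dcdf[OF that]])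
  have F_integrable: "set_integrable lborel {..x} (F n)" if "x < \<Omega>" for n x
    using that cdf_integrable[OF s(1)] cdf_integrable[OF l]
    unfolding F_def q_def by (intro set_integrable_divide set_integral_diff(1)) auto
  have F_integral: "(LBINT t:{..x}. F n t) = q (\<lambda>m. int_cdf f m x) n" if "x < \<Omega>" for n x
    using that cdf_integrable[OF s(1)] cdf_integrable[OF l]
    unfolding F_def q_def int_cdf_def
    by (subst set_integral_divide_zero, subst set_integral_diff(2)) auto
  have F_integral_lim: "(\<lambda>n. LBINT t:{..x}. F n t) \<longlonglongrightarrow> (LBINT t:{..x}. dcdf t)" if "x < \<Omega>" for x
    unfolding F_integral[OF that] dint_def[symmetric] by (rule q_tendsto[OF int_cdf_deriv[OF that]])
  have F_integrable': "set_integrable lborel {K..\<kappa>} (F n)" for n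
    by (rule set_integrable_subset[OF F_integrable[OF \<kappa>_less]]) auto
  have F_integral_lim': "(\<lambda>n. LBINT t:{K..\<kappa>}. F n t) \<longlonglongrightarrow> (LBINT t:{K..\<kappa>}. dcdf t)"
  proof -
    have *: "(LBINT t:{K..\<kappa>}. h t) = (LBINT t:{..\<kappa>}. h t) - (LBINT t:{..K}. h t)"
      if "set_integrable lborel {..\<kappa>} h" for h :: "real \<Rightarrow> real"
      using set_integral_split_Iic[OF that, of K] K_less by simp
    show ?thesis
      unfolding *[OF F_integrable[OF \<kappa>_less]] *[OF dcdf_integrable[OF \<kappa>_less]]
      by (intro tendsto_diff F_integral_lim \<kappa>_less K_less_\<Omega>)
  qed
  have lim_trunc: "(\<lambda>n. LBINT x:{..K}. trunc x * F n x) \<longlonglongrightarrow> (LBINT x:{..K}. trunc x * dcdf x)"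
    by (rule tendsto_weighted_integral_Scheffe[OF F_integrable dcdf_integrable _ _ _ _ F_integral_lim _ trunc_bound])
      (use K_less_\<Omega> in \<open>auto intro: F_nonneg F_lim less_imp_le[OF dcdf_pos]\<close>)
  have lim_w: "(\<lambda>n. LBINT x:{K..\<kappa>}. w x * F n x) \<longlonglongrightarrow> (LBINT x:{K..\<kappa>}. w x * dcdf x)"
    by (rule tendsto_weighted_integral_Scheffe[OF F_integrable' dcdf_integrable_Icc _ _ _ _ F_integral_lim' _ w_bound])
      (use \<kappa>_less in \<open>auto intro: F_nonneg F_lim less_imp_le[OF dcdf_pos]\<close>)
  \<comment> \<open>The quotients of \<open>u\<close> and \<open>Z\<close> are A + B and A + C. Only
    \<open>B\<close> and \<open>C\<close> are known to converge; \<open>A\<close> is bounded below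
    by its truncation \<open>A'\<close>, which converges.\<close>
  define A where "A n = (LBINT x:{..K}. w x * F n x)" for n
  define A' where "A' n = (LBINT x:{..K}. trunc x * F n x)" for n
  define B where "B n = a * q (semi_dev \<Omega> f) n + (LBINT x:{K..\<kappa>}. w x * F n x)" for n
  define C where "C n = a * q (shortfall K) n + (\<psi> \<kappa> - \<psi> K) * F n K" for n
  have w_quot: "set_integrable lborel {..x} (\<lambda>t. w t * F n t)"
      "(LBINT t:{..x}. w t * F n t) = q (\<lambda>m. LBINT t:{..x}. w t * cdf_at f m t) n"
    if "x \<le> \<kappa>" for n x
  proof -
    note i = weighted_cdf_integrable[OF s(1) that, of n] weighted_cdf_integrable[OF l that]
    have eq: "(\<lambda>t. w t * F n t) = (\<lambda>t. (w t * cdf_at f (s n) t - w t * cdf_at f l t) / (s n - l))"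
      by (simp add: F_def q_def right_diff_distrib)
    show "set_integrable lborel {..x} (\<lambda>t. w t * F n t)"
      unfolding eq by (intro set_integrable_divide set_integral_diff(1) i)
    show "(LBINT t:{..x}. w t * F n t) = q (\<lambda>m. LBINT t:{..x}. w t * cdf_at f m t) n"
      unfolding eq q_def using i by simp
  qed
  have u_quot: "q u n = A n + B n" for n
  proof -
    have "q u n = a * q (semi_dev \<Omega> f) n + (LBINT t:{..\<kappa>}. w t * F n t)"
      unfolding w_quot(2)[OF order_refl] by (simp add: q_def u_def diff_divide_distrib add_divide_distrib algebra_simps)
    then show ?thesis
      using set_integral_split_Iic[OF w_quot(1)[OF order_refl], of K n] K_less by (simp add: A_def B_def)
  qed
  have Z_quot: "q Z n = A n + C n" for n
  proof -
    have "A n = q (\<lambda>m. LBINT t:{..K}. w t * cdf_at f m t) n"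
      unfolding A_def by (rule w_quot(2)) (use K_less in simp)
    then show ?thesis
      by (simp add: q_def C_def F_def Z_def diff_divide_distrib add_divide_distrib algebra_simps)
  qed
  have A_ge: "A' n \<le> A n" for n
    unfolding A_def A'_def
  proof (rule set_integral_mono)
    show "set_integrable lborel {..K} (\<lambda>x. trunc x * F n x)"
      by (rule set_integrable_mult_bounded[OF F_integrable[OF K_less_\<Omega>] _ trunc_bound]) auto
    show "set_integrable lborel {..K} (\<lambda>x. w x * F n x)"
      using w_quot(1) K_less by simp
    show "trunc x * F n x \<le> w x * F n x" if "x \<in> {..K}" for x
      using that F_nonneg[of x n] K_less_\<Omega> by (auto simp: trunc_def intro!: mult_right_mono)
  qed
  have B_lim: "B \<longlonglongrightarrow> a * ddev + (LBINT x:{K..\<kappa>}. w x * dcdf x)"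
    unfolding B_def by (intro tendsto_intros q_tendsto ddev lim_w)
  have C_lim: "C \<longlonglongrightarrow> a * vega K + (\<psi> \<kappa> - \<psi> K) * dcdf K"
    unfolding C_def by (intro tendsto_intros q_tendsto shortfall_deriv F_lim K_less_\<Omega>)
  have gap: "gap = (1 - level) * (LBINT x:{..K}. trunc x * dcdf x) + (a * vega K + (\<psi> \<kappa> - \<psi> K) * dcdf K)
      - level * (a * ddev + (LBINT x:{K..\<kappa>}. w x * dcdf x))"
    by (simp add: gap_def algebra_simps flip: level_bounds(3))
  have gap_lim: "(\<lambda>n. (1 - level) * A' n + C n - level * B n) \<longlonglongrightarrow> gap"
    unfolding A'_def gap by (intro tendsto_intros lim_trunc B_lim C_lim)
  \<comment> \<open>Half of the limit is an eventual lower bound for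
    \<open>q Z n - level * q u n\<close>. The constant \<open>R\<close> bounds
    \<open>q u n - q Z n\<close> for every n, since \<open>A\<close> cancels in B - C.\<close>
  define d where "d = gap / 2"
  obtain R where R: "0 < R" "\<And>n. B n - C n \<le> R"
  proof -
    have "Bseq (\<lambda>n. B n - C n)"
      using tendsto_diff[OF B_lim C_lim] by (intro convergent_imp_Bseq convergentI)
    then obtain R where "0 < R" "\<And>n. norm (B n - C n) \<le> R"
      by (auto simp: Bseq_def)
    then show thesis
      by (intro that[of R]) (auto simp: abs_le_iff)
  qed
  have d: "0 < d"
    using gap_pos by (simp add: d_def)
  have q_u_pos: "0 < q u n" for n
    using u_less[OF l s(1) s(2)] s(2)[of n] by (simp add: q_def)
  have "(\<lambda>n. (\<zeta> (u (s n)) - \<zeta> (u l)) / (u (s n) - u l)) \<longlonglongrightarrow> W"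
    by (rule quotient_tendsto[OF \<zeta> u_tendsto[OF b s]])
      (use u_less[OF l s(1) s(2)] in \<open>simp add: less_imp_neq[symmetric]\<close>)
  \<comment> \<open>The parameter increments cancel in the ratio, leaving a difference quotient of
    \<zeta>.\<close>
  then have ratio_lim: "(\<lambda>n. q Z n / q u n) \<longlonglongrightarrow> W"
    using ne by (simp add: \<zeta>_u l s(1) q_def)
  \<comment> \<open>Take R times \<open>q Z n - level * q u n\<close> \<ge> d and add d times
    \<open>q Z n - q u n\<close> \<ge> -R: the constants cancel. The bound is the mean of
    \<open>level\<close> and 1 with weights R and d, so it exceeds \<open>level\<close> however
    large the \<open>u\<close>-quotient becomes.\<close>
  have "\<forall>\<^sub>F n in sequentially. (level * R + d) / (R + d) \<le> q Z n / q u n"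
  proof -
    have "\<forall>\<^sub>F n in sequentially. d < (1 - level) * A' n + C n - level * B n"
      using gap_pos by (intro order_tendstoD(1)[OF gap_lim]) (simp add: d_def)
    then show ?thesis
    proof eventually_elim
      case (elim n)
      have "(1 - level) * A' n \<le> (1 - level) * A n"
        using A_ge level_bounds by (intro mult_left_mono) auto
      then have "d \<le> q Z n - level * q u n"
        using elim by (simp add: u_quot Z_quot algebra_simps)
      then have "R * d \<le> R * (q Z n - level * q u n)"
        using R(1) by (intro mult_left_mono) auto
      moreover have "d * (- R) \<le> d * (q Z n - q u n)"
        using R(2)[of n] d by (intro mult_left_mono) (auto simp: u_quot Z_quot)
      ultimately have "(level * R + d) * q u n \<le> q Z n * (R + d)"
        by (simp add: algebra_simps)
      then show ?case
        using q_u_pos[of n] R(1) d by (simp add: frac_le_eq divide_le_eq field_simps)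
    qed
  qed
  then have "(level * R + d) / (R + d) \<le> W"
    by (intro tendsto_lowerbound[OF ratio_lim]) auto
  moreover have "level < (level * R + d) / (R + d)"
    using level_bounds(2) R(1) d by (simp add: field_simps)
  ultimately show ?thesis
    by simp
qed

end

section \<open>Application to Y = \<phi>(X)\<close>

context fragility_family_at
begin

text \<open>Pulled back to X, the semi-deviation of Y is \<open>u\<close> and its shortfall at
  \<phi>(K) is \<open>Z\<close>. The function that sends the former to the latter has the fragility
  of Y as its derivative, so \<open>level_less_deriv\<close> applies.\<close>

lemma fragility_transform_less:
  fixes M :: "real \<Rightarrow> 'a measure" and X :: "'a \<Rightarrow> real"
  assumes K: "K < \<kappa>" "\<kappa> < \<Omega>" and less: "vega K < ddev"
    and transfer: "\<And>x. x \<le> \<kappa> \<Longrightarrow> 0 < transfer_fn \<Omega> f K l x"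
    and X: "\<And>m. m \<in> I \<Longrightarrow> has_pdf (M m) X (f m)"
    and Y: "\<And>m. m \<in> I \<Longrightarrow> has_pdf (M m) (\<lambda>\<omega>. \<phi> (X \<omega>)) (g m)"
    and cv: "change_of_variable \<Omega> \<phi>"
    and concave: "concave_on {..\<kappa>} \<phi>" and nonaffine: "\<not> affine_fun_on {..\<kappa>} \<phi>"
    and affine: "affine_fun_on {\<kappa>..\<Omega>} \<phi>"
    and defined: "fragility_defined I \<Omega> g (\<phi> K) l"
  shows "fragility I \<Omega> f K (semi_dev \<Omega> f l) < fragility I \<Omega> g (\<phi> K) (semi_dev \<Omega> g l)"
proof -
  have mono: "strict_mono \<phi>" and \<phi>_\<Omega>: "\<phi> \<Omega> = \<Omega>"
    and d\<phi>: "\<And>x. (\<phi> has_real_derivative deriv \<phi> x) (at x)"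
    and d2\<phi>: "\<And>x. deriv \<phi> differentiable (at x)"
    and d\<phi>_pos: "\<And>x. x < \<Omega> \<Longrightarrow> 0 < deriv \<phi> x"
    using cv by (auto simp: change_of_variable_def DERIV_deriv_iff_real_differentiable)
  have cont: "isCont (deriv \<phi>) x" for x
    using d2\<phi> by (intro differentiable_imp_continuous_within)
  have meas [measurable]: "deriv \<phi> \<in> borel_measurable borel"
    using cont by (intro borel_measurable_continuous_onI continuous_at_imp_continuous_on) auto
  obtain a b where ab: "\<And>x. \<kappa> \<le> x \<Longrightarrow> x \<le> \<Omega> \<Longrightarrow> \<phi> x = a * x + b"
    using affine unfolding affine_fun_on_def by auto
  have a: "deriv \<phi> \<kappa> = a"
    by (rule affine_slope_eq_deriv[OF d\<phi> K(2) ab])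
  have a_pos: "0 < a"
    using d\<phi>_pos[OF K(2)] a by simp
  define \<psi> w where "\<psi> x = \<phi> x - a * x" and "w x = deriv \<phi> x - a" for x
  have \<psi>_deriv: "(\<psi> has_real_derivative w x) (at x)" for x
    unfolding \<psi>_def w_def by (auto intro!: derivative_eq_intros d\<phi>)
  have above: "\<Omega> - \<phi> x = a * (\<Omega> - x)" if "\<kappa> \<le> x" "x \<le> \<Omega>" for x
    using ab[of x] ab[of \<Omega>] that K \<phi>_\<Omega> by (simp add: algebra_simps)
  have split: "\<Omega> - \<phi> x = a * (\<Omega> - x) + (\<psi> \<kappa> - \<psi> x)" for x
    using above[of \<kappa>] K by (simp add: \<psi>_def algebra_simps)
  have w_nonzero: "\<exists>x\<le>\<kappa>. w x \<noteq> 0"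
  proof (rule ccontr)
    assume "\<not> (\<exists>x\<le>\<kappa>. w x \<noteq> 0)"
    then have w0: "w x = 0" if "x \<le> \<kappa>" for x
      using that by blast
    have "\<psi> x = \<psi> \<kappa>" if "x \<le> \<kappa>" for x
    proof (rule antisym)
      show "\<psi> x \<le> \<psi> \<kappa>"
        by (rule DERIV_nonneg_imp_nondecreasing[OF that]) (use \<psi>_deriv w0 in force)
      show "\<psi> \<kappa> \<le> \<psi> x"
        by (rule DERIV_nonpos_imp_nonincreasing[OF that]) (use \<psi>_deriv w0 in force)
    qed
    then have "\<phi> x = a * x + \<psi> \<kappa>" if "x \<le> \<kappa>" for x
      using that by (simp add: \<psi>_def algebra_simps)
    then show False
      using nonaffine by (auto simp: affine_fun_on_def)
  qed
  have pull: "set_integrable lborel {..\<phi> z} (\<lambda>y. (\<Omega> - y) * g m y) \<longleftrightarrow>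
        set_integrable lborel {..z} (\<lambda>x. (\<Omega> - \<phi> x) * f m x)"
      "(LBINT y:{..\<phi> z}. (\<Omega> - y) * g m y) = (LBINT x:{..z}. (\<Omega> - \<phi> x) * f m x)"
    if "m \<in> I" for m z
    by (rule pdf_pullback[OF X[OF that] Y[OF that] mono]; measurable)+
  \<comment> \<open>Finiteness of the semi-deviations of Y, contained in
    \<open>fragility_defined\<close>, is transported to the law of X.\<close>
  have int\<phi>: "set_integrable lborel {..\<Omega>} (\<lambda>x. (\<Omega> - \<phi> x) * f m x)" if "m \<in> I" for m
    using pull(1)[OF that, of \<Omega>] defined that by (simp add: fragility_defined_def \<phi>_\<Omega>)
  have \<psi>_integrable: "set_integrable lborel {..\<kappa>} (\<lambda>x. (\<psi> \<kappa> - \<psi> x) * f m x)" if "m \<in> I" for m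
  proof -
    have "set_integrable lborel {..\<Omega>} (\<lambda>x. (\<Omega> - \<phi> x) * f m x - a * ((\<Omega> - x) * f m x))"
      by (intro set_integral_diff(1) int\<phi> set_integrable_mult_right dev_finite that)
    then have "set_integrable lborel {..\<Omega>} (\<lambda>x. (\<psi> \<kappa> - \<psi> x) * f m x)"
      by (simp add: split algebra_simps)
    then show ?thesis
      by (rule set_integrable_subset) (use K in auto)
  qed
  interpret concave_stress I \<Omega> f l K \<kappa> a \<psi> w
  proof
    show "w \<in> borel_measurable borel"
      unfolding w_def by measurable
    show "w y \<le> w x" if "x \<le> y" "y \<le> \<kappa>" for x y
      using concave_on_deriv_antimono[OF d\<phi> cont concave that] by (simp add: w_def)
    show "w \<kappa> = 0"
      by (simp add: w_def a)
  qed (use K less transfer a_pos \<psi>_deriv w_nonzero \<psi>_integrable in auto)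
  have dev_u: "semi_dev \<Omega> g m = u m" if m: "m \<in> I" for m
  proof -
    have i: "set_integrable lborel {..\<Omega>} (\<lambda>x. a * ((\<Omega> - x) * f m x))"
      using dev_finite[OF m] by simp
    have j: "set_integrable lborel {..\<Omega>} (\<lambda>x. indicator {..\<kappa>} x * ((\<psi> \<kappa> - \<psi> x) * f m x))"
      "(LBINT x:{..\<Omega>}. indicator {..\<kappa>} x * ((\<psi> \<kappa> - \<psi> x) * f m x))
        = (LBINT x:{..\<kappa>}. (\<psi> \<kappa> - \<psi> x) * f m x)"
    proof -
      have eq: "indicator {..\<Omega>} x *\<^sub>R (indicator {..\<kappa>} x * ((\<psi> \<kappa> - \<psi> x) * f m x))
          = indicator {..\<kappa>} x *\<^sub>R ((\<psi> \<kappa> - \<psi> x) * f m x)" for x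
        using K by (auto simp: indicator_def)
      show "set_integrable lborel {..\<Omega>} (\<lambda>x. indicator {..\<kappa>} x * ((\<psi> \<kappa> - \<psi> x) * f m x))"
        using \<psi>_integrable[OF m] unfolding set_integrable_def eq .
      show "(LBINT x:{..\<Omega>}. indicator {..\<kappa>} x * ((\<psi> \<kappa> - \<psi> x) * f m x))
        = (LBINT x:{..\<kappa>}. (\<psi> \<kappa> - \<psi> x) * f m x)"
        unfolding set_lebesgue_integral_def eq ..
    qed
    have "semi_dev \<Omega> g m = (LBINT x:{..\<Omega>}. (\<Omega> - \<phi> x) * f m x)"
      using pull(2)[OF m, of \<Omega>] by (simp add: semi_dev_def \<phi>_\<Omega>)
    \<comment> \<open>Above \<kappa> the distance \<Omega> - \<phi>(x) is exactly a(\<Omega> - x);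
      the correction by \<psi> occurs only on \<open>{..\<kappa>}\<close>.\<close>
    also have "\<dots> = (LBINT x:{..\<Omega>}. a * ((\<Omega> - x) * f m x)
        + indicator {..\<kappa>} x * ((\<psi> \<kappa> - \<psi> x) * f m x))"
    proof (rule set_lebesgue_integral_cong)
      show "\<forall>x. x \<in> {..\<Omega>} \<longrightarrow> (\<Omega> - \<phi> x) * f m x
          = a * ((\<Omega> - x) * f m x) + indicator {..\<kappa>} x * ((\<psi> \<kappa> - \<psi> x) * f m x)"
      proof (intro allI impI)
        fix x assume "x \<in> {..\<Omega>}"
        then show "(\<Omega> - \<phi> x) * f m x
            = a * ((\<Omega> - x) * f m x) + indicator {..\<kappa>} x * ((\<psi> \<kappa> - \<psi> x) * f m x)"
          using above[of x] split[of x] by (cases "x \<le> \<kappa>") (simp_all add: distrib_right)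
      qed
    qed simp
    also have "\<dots> = u m"
      using i j weighted_cdf_parts(2)[OF m order_refl]
      by (simp add: u_def semi_dev_def)
    finally show ?thesis .
  qed
  have tail_Z: "tail_shortfall I \<Omega> g (\<phi> K) (u m) = Z m" if m: "m \<in> I" for m
  proof -
    have "inj_on (semi_dev \<Omega> g) I"
      using u_inj dev_u by (simp cong: inj_on_cong)
    then have "dev_param I \<Omega> g (u m) = m"
      using m by (simp add: dev_param_def the_inv_into_f_f flip: dev_u)
    then have "tail_shortfall I \<Omega> g (\<phi> K) (u m) = (LBINT x:{..K}. (\<Omega> - \<phi> x) * f m x)"
      using pull(2)[OF m, of K] by (simp add: tail_shortfall_def)
    \<comment> \<open>Splitting \<psi>(\<kappa>) - \<psi>(x) at \<open>K\<close> separates a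
      multiple of the distribution function at \<open>K\<close> from a part to which integration by
      parts on \<open>{..K}\<close> applies.\<close>
    also have "\<dots> = (LBINT x:{..K}. a * ((\<Omega> - x) * f m x) + (\<psi> \<kappa> - \<psi> K) * f m x
        + (\<psi> K - \<psi> x) * f m x)"
      by (simp add: split algebra_simps)
    also have "\<dots> = Z m"
    proof -
      have i: "set_integrable lborel {..K} (\<lambda>x. a * ((\<Omega> - x) * f m x))"
        using linear_density_integrable[OF m, of K] K by simp
      have j: "set_integrable lborel {..K} (\<lambda>x. (\<psi> \<kappa> - \<psi> K) * f m x)"
        using density_set_integrable[OF m, of "{..K}"] by simp
      note k = weighted_cdf_parts[OF m less_imp_le[OF K(1)]]
      show ?thesis
        using i j k by (simp add: set_integral_add Z_def shortfall_def cdf_at_def[of f m K])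
    qed
    finally show ?thesis .
  qed
  have "(tail_shortfall I \<Omega> g (\<phi> K) has_real_derivative
      fragility I \<Omega> g (\<phi> K) (semi_dev \<Omega> g l)) (at (u l))"
    using defined dev_u[OF l]
    by (simp add: fragility_defined_def fragility_def DERIV_deriv_iff_real_differentiable)
  from level_less_deriv[OF this tail_Z]
  show ?thesis
    using fragility_eq[OF K_less_\<Omega>] by (simp add: level_def)
qed

end

theorem theorem2:
  fixes I :: "real set" and \<Omega> l :: real and f :: "real \<Rightarrow> real \<Rightarrow> real"
    and M :: "real \<Rightarrow> 'a measure" and X :: "'a \<Rightarrow> real"
  assumes "fragility_family I \<Omega> f"
    and "\<And>m. m \<in> I \<Longrightarrow> prob_space (M m)"
    and "\<And>m. m \<in> I \<Longrightarrow> has_pdf (M m) X (f m)"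
    and "l \<in> I" and "0 < semi_dev \<Omega> f l"
  shows "\<exists>\<Theta><\<Omega>. \<forall>K\<le>\<Theta>. \<exists>\<kappa>. K < \<kappa> \<and> \<kappa> < \<Omega> \<and>
           (\<forall>x\<le>\<kappa>. 0 < transfer_fn \<Omega> f K l x) \<and>
           (\<forall>\<phi> g. change_of_variable \<Omega> \<phi> \<and>
                  concave_on {..\<kappa>} \<phi> \<and> \<not> affine_fun_on {..\<kappa>} \<phi> \<and>
                  affine_fun_on {\<kappa>..\<Omega>} \<phi> \<and>
                  (\<forall>m\<in>I. has_pdf (M m) (\<lambda>\<omega>. \<phi> (X \<omega>)) (g m)) \<and>
                  fragility_defined I \<Omega> g (\<phi> K) l
              \<longrightarrow> fragility I \<Omega> f K (semi_dev \<Omega> f l)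
                    < fragility I \<Omega> g (\<phi> K) (semi_dev \<Omega> g l))"
proof -
  interpret fragility_family_at I \<Omega> f l
    using assms by (simp add: fragility_family_at_def fragility_family_at_axioms_def)
  obtain \<Theta> where \<Theta>: "\<Theta> < \<Omega>" "\<And>K. K \<le> \<Theta> \<Longrightarrow> vega K < ddev"
    by (rule threshold_exists) blast
  show ?thesis
  proof (rule exI[of _ \<Theta>], intro conjI allI impI)
    show "\<Theta> < \<Omega>" by (rule \<Theta>)
    fix K assume "K \<le> \<Theta>"
    then have K: "K < \<Omega>" "vega K < ddev"
      using \<Theta> by auto
    obtain \<kappa> where \<kappa>: "K < \<kappa>" "\<kappa> < \<Omega>" "\<And>x. x \<le> \<kappa> \<Longrightarrow> 0 < transfer_fn \<Omega> f K l x"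
      by (rule transfer_fn_pos_range[OF K]) blast
    show "\<exists>\<kappa>. K < \<kappa> \<and> \<kappa> < \<Omega> \<and>
           (\<forall>x\<le>\<kappa>. 0 < transfer_fn \<Omega> f K l x) \<and>
           (\<forall>\<phi> g. change_of_variable \<Omega> \<phi> \<and>
                  concave_on {..\<kappa>} \<phi> \<and> \<not> affine_fun_on {..\<kappa>} \<phi> \<and>
                  affine_fun_on {\<kappa>..\<Omega>} \<phi> \<and>
                  (\<forall>m\<in>I. has_pdf (M m) (\<lambda>\<omega>. \<phi> (X \<omega>)) (g m)) \<and>
                  fragility_defined I \<Omega> g (\<phi> K) l
              \<longrightarrow> fragility I \<Omega> f K (semi_dev \<Omega> f l)
                    < fragility I \<Omega> g (\<phi> K) (semi_dev \<Omega> g l))"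
      using \<kappa> fragility_transform_less[OF \<kappa>(1,2) K(2) \<kappa>(3) assms(3)]
      by (intro exI[of _ \<kappa>]) auto
  qed
qed

end
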